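(* Let $n$ be an even positive integer, write $n=2m$, let $x\in\mathbb{R}$ and let $a=(a^0,\dots,a^n)\in\mathbb{R}^{n+1}$. The following statements are equivalent: (1) Problem $\partial CF\mathcal{P}(\mathbb{R})$ with data $x,a$ has a weak solution; (2) Problem $\partial CF\mathcal{P}(\mathbb{R})$ with data $x,a$ has a nontangential solution; (3) Problem $\partial CF\mathcal{P}(\mathbb{R})$ with data $x,a$ has a radial solution; (4) Problem $\partial CF\mathcal{P}(\mathbb{R})$ with data $x,a$ has a solution which is analytic at $x$; (5) either the associated Hankel matrix $H_m(a)$ is positive definite, or both $H_m(a)$ is SE-minimally positive and $a^n$ satisfies $$( * )\qquad a^{n}=\begin{bmatrix} a^m & a^{m+1}&\dots&a^{m+r-1}\end{bmatrix}\,H_r(a)^{-1}\begin{bmatrix}a^{m+1}\\ a^{m+2}\\ \vdots\\ a^{m+r}\end{bmatrix},$$ where $r=\operatorname{rank}H_m(a)$. Moreover, the problem has a unique solution if and only if $H_m(a)$ is SE-minimally positive and $a^n$ satisfies $( * )$.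
   Context: Let $\Pi=\{z\in\mathbb{C}:\operatorname{Im} z>0\}$. The Pick class $\mathcal{P}$ is the set of analytic functions $f$ on $\Pi$ with $\operatorname{Im} f\ge 0$ on $\Pi$. For $x\in\mathbb{R}$, $z\to x$ nontangentially means that $z\to x$ with $z$ remaining in a set $S\subset\Pi$, with $x$ in the closure of $S$, on which $|z-x|/\operatorname{Im} z$ is bounded (a limit holds nontangentially if it holds along every such $S$). Write $h(z)=o_{\rm nt}((z-x)^n)$ if $h(z)/(z-x)^n\to 0$ as $z\to x$ nontangentially in $\Pi$. Problem $\partial CF\mathcal{P}(\mathbb{R})$ with data $x\in\mathbb{R}$, $a^0,\dots,a^n\in\mathbb{R}$: find $f\in\mathcal{P}$ such that $f$ is analytic at $x$ (i.e. extends analytically to a neighbourhood of $x$) and $f^{(k)}(x)/k!=a^k$ for $k=0,1,\dots,n$. Such an $f$ is a solution (analytic at $x$). A function $f\in\mathcal{P}$ is a weak solution of the problem if $f(z)=a^0+a^1(z-x)+\dots+a^n(z-x)^n+o_{\rm nt}((z-x)^n)$. It is a nontangential solution if $f^{(k)}(z)/k!\to a^k$ as $z\to x$ nontangentially in $\Pi$, for $k=0,\dots,n$. It is a radial solution if $\lim_{y\to0+}f^{(k)}(x+\mathrm{i}y)/k!=a^k$ for $k=0,\dots,n$. For $a=(a^0,\dots,a^n)$ and a positive integer $k$ with $2k-1\le n$, $H_k(a)$ is the $k\times k$ Hankel matrix $[a^{i+j-1}]_{i,j=1}^k$ (superscripts are indices). A Hermitian matrix is called positive, written $\ge0$, if it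 is positive semidefinite. $H_m(a)$ is southeast-minimally (SE-minimally) positive if $H_m(a)\ge0$ and, for every $\varepsilon>0$, $H_m(a)-\operatorname{diag}\{0,\dots,0,\varepsilon\}$ is not positive. When $r=0$ the right-hand side of $( * )$ is an empty product and $( * )$ is read as $a^n=0$. *)

theory Defs
  imports
    "HOL-Complex_Analysis.Complex_Analysis"
    "Jordan_Normal_Form.DL_Rank"
    "Jordan_Normal_Form.Gauss_Jordan_Elimination"
begin

(* HOL-Analysis and Jordan_Normal_Form both claim this infix;
   from here on it is the scalar product of Jordan_Normal_Form vectors. *)
unbundle no inner_syntax

definition upper_half_plane :: "complex set" where
  "upper_half_plane = {z. Im z > 0}"

(* Elements of the Pick class are represented by total functions; only their values on the
   upper half-plane are meaningful, and the values elsewhere are never used below. *)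
definition pick_class :: "(complex \<Rightarrow> complex) set" where
  "pick_class = {f. f holomorphic_on upper_half_plane \<and> (\<forall>z\<in>upper_half_plane. 0 \<le> Im (f z))}"

definition nontangential_set :: "real \<Rightarrow> complex set \<Rightarrow> bool" where
  "nontangential_set x S \<longleftrightarrow>
     S \<subseteq> upper_half_plane \<and> complex_of_real x \<in> closure S \<and>
     bounded ((\<lambda>z. cmod (z - complex_of_real x) / Im z) ` S)"

definition nt_tendsto :: "(complex \<Rightarrow> complex) \<Rightarrow> complex \<Rightarrow> real \<Rightarrow> bool" where
  "nt_tendsto h l x \<longleftrightarrow>
     (\<forall>S. nontangential_set x S \<longrightarrow> (h \<longlongrightarrow> l) (at (complex_of_real x) within S))"

definition little_o_nt :: "(complex \<Rightarrow> complex) \<Rightarrow> nat \<Rightarrow> real \<Rightarrow> bool" where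
  "little_o_nt h n x \<longleftrightarrow> nt_tendsto (\<lambda>z. h z / (z - complex_of_real x) ^ n) 0 x"

(* Data a^0, ..., a^n are given by a function on nat, of which only the values at 0, ..., n
   are used. *)

definition analytic_solution :: "real \<Rightarrow> nat \<Rightarrow> (nat \<Rightarrow> real) \<Rightarrow> (complex \<Rightarrow> complex) \<Rightarrow> bool" where
  "analytic_solution x n a f \<longleftrightarrow>
     f \<in> pick_class \<and>
     (\<exists>U g. open U \<and> complex_of_real x \<in> U \<and> g holomorphic_on U \<and>
        (\<forall>z \<in> U \<inter> upper_half_plane. g z = f z) \<and>
        (\<forall>k\<le>n. (deriv ^^ k) g (complex_of_real x) / fact k = complex_of_real (a k)))"

definition weak_solution :: "real \<Rightarrow> nat \<Rightarrow> (nat \<Rightarrow> real) \<Rightarrow> (complex \<Rightarrow> complex) \<Rightarrow> bool" where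
  "weak_solution x n a f \<longleftrightarrow>
     f \<in> pick_class \<and>
     little_o_nt
       (\<lambda>z. f z - (\<Sum>k\<le>n. complex_of_real (a k) * (z - complex_of_real x) ^ k)) n x"

definition nontangential_solution ::
  "real \<Rightarrow> nat \<Rightarrow> (nat \<Rightarrow> real) \<Rightarrow> (complex \<Rightarrow> complex) \<Rightarrow> bool" where
  "nontangential_solution x n a f \<longleftrightarrow>
     f \<in> pick_class \<and>
     (\<forall>k\<le>n. nt_tendsto (\<lambda>z. (deriv ^^ k) f z / fact k) (complex_of_real (a k)) x)"

definition radial_solution :: "real \<Rightarrow> nat \<Rightarrow> (nat \<Rightarrow> real) \<Rightarrow> (complex \<Rightarrow> complex) \<Rightarrow> bool" where
  "radial_solution x n a f \<longleftrightarrow>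
     f \<in> pick_class \<and>
     (\<forall>k\<le>n. ((\<lambda>y. (deriv ^^ k) f (Complex x y) / fact k) \<longlongrightarrow> complex_of_real (a k)) (at_right 0))"

(* Uniqueness is equality as functions on the upper half-plane. *)
definition has_unique_solution :: "real \<Rightarrow> nat \<Rightarrow> (nat \<Rightarrow> real) \<Rightarrow> bool" where
  "has_unique_solution x n a \<longleftrightarrow>
     (\<exists>f. analytic_solution x n a f \<and>
        (\<forall>g. analytic_solution x n a g \<longrightarrow> (\<forall>z\<in>upper_half_plane. g z = f z)))"

(* With indices i, j = 1, ..., k the (i, j) entry is a^(i+j-1); matrix indices here start at 0. *)
definition hankel :: "nat \<Rightarrow> (nat \<Rightarrow> real) \<Rightarrow> real mat" where
  "hankel k a = Matrix.mat k k (\<lambda>(i, j). a (i + j + 1))"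

definition pos_semidefinite :: "real mat \<Rightarrow> bool" where
  "pos_semidefinite A \<longleftrightarrow>
     square_mat A \<and> A\<^sup>T = A \<and> (\<forall>v \<in> carrier_vec (dim_row A). 0 \<le> v \<bullet> (A *\<^sub>v v))"

definition pos_definite :: "real mat \<Rightarrow> bool" where
  "pos_definite A \<longleftrightarrow>
     square_mat A \<and> A\<^sup>T = A \<and>
     (\<forall>v \<in> carrier_vec (dim_row A). v \<noteq> 0\<^sub>v (dim_row A) \<longrightarrow> 0 < v \<bullet> (A *\<^sub>v v))"

definition SE_minimally_positive :: "nat \<Rightarrow> real mat \<Rightarrow> bool" where
  "SE_minimally_positive m A \<longleftrightarrow>
     pos_semidefinite A \<and>
     (\<forall>\<epsilon>>0. \<not> pos_semidefinite (A - mat_diag m (\<lambda>i. if i = m - 1 then \<epsilon> else 0)))"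

(* The equation (a^m ... a^(m+r-1)) H_r(a)^(-1) (a^(m+1) ... a^(m+r))^T = a^n with n = 2m;
   it includes the assertion that H_r(a) is invertible. For r = 0 it reads a^n = 0. *)
definition star_condition :: "nat \<Rightarrow> nat \<Rightarrow> (nat \<Rightarrow> real) \<Rightarrow> bool" where
  "star_condition m r a \<longleftrightarrow>
     (\<exists>B. mat_inverse (hankel r a) = Some B \<and>
        a (2 * m) = Matrix.vec r (\<lambda>i. a (m + i)) \<bullet> (B *\<^sub>v Matrix.vec r (\<lambda>i. a (m + 1 + i))))"

lemma star_condition_0: "star_condition m 0 a \<longleftrightarrow> a (2 * m) = 0"
proof -
  have H: "hankel 0 a \<in> carrier_mat 0 0"
    by (simp add: hankel_def)
  have "hankel 0 a \<in> Units (ring_mat TYPE(real) 0 ())"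
    unfolding Units_def ring_mat_def
    using H by (auto intro!: bexI[of _ "hankel 0 a"] eq_matI)
  then obtain B where "mat_inverse (hankel 0 a) = Some B"
    using mat_inverse(1)[OF H, of "()"] by (cases "mat_inverse (hankel 0 a)") auto
  then show ?thesis
    using mat_inverse(2)[OF H] by (auto simp: star_condition_def scalar_prod_def)
qed

end

theory Submission
  imports Defs
begin

(* From here on the infix $ denotes entries of Jordan_Normal_Form vectors only. *)
unbundle no fps_syntax
unbundle no vec_syntax

text \<open>
  The proof is an induction on \<open>m\<close> by Julia reduction at \<open>x\<close>. If \<open>f\<close> in the Pick class satisfies
  \<open>f(z) = a\<^sup>0 + a\<^sup>1(z - x) + \<dots>\<close> along the vertical line through \<open>x\<close>, the Schwarz--Pick inequality for
  \<open>z\<close> and \<open>w = x + \<i>y\<close>, in the limit \<open>y \<rightarrow> 0\<close>, becomes Julia's inequality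
  \<open>|f(z) - a\<^sup>0|\<^sup>2 Im z \<le> a\<^sup>1 |z - x|\<^sup>2 Im f(z)\<close>. Hence \<open>f\<close> is constant if \<open>a\<^sup>1 = 0\<close>, and if \<open>a\<^sup>1 > 0\<close>
  then \<open>g(z) = 1/(a\<^sup>1(z - x)) - 1/(f(z) - a\<^sup>0)\<close> is again in the Pick class and solves the problem for
  data \<open>b\<close> with two coefficients fewer. This step is invertible and preserves analyticity at \<open>x\<close>.
  On the algebraic side \<open>H\<^sub>m(a)\<close> is congruent, through an invertible triangular Toeplitz matrix, to
  \<open>1/a\<^sup>1 \<oplus> H\<^sub>m\<^sub>-\<^sub>1(b)\<close>, which transports positive definiteness, SE-minimality and the condition on
  \<open>a\<^sup>n\<close>. The latter two together say that for some \<open>r < m\<close> the matrix \<open>H\<^sub>r(a)\<close> is positive definite and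
  \<open>a\<^sup>1, \<dots>, a\<^sup>n\<close> satisfies a linear recurrence of order \<open>r\<close>; then \<open>r\<close> reductions lead to the zero
  sequence, for which only a constant is a solution. All solution concepts enter only through the
  expansion of \<open>f\<close> along the vertical line, which is the weakest of them.
\<close>

section \<open>Hankel forms and reduction of the data\<close>

text \<open>With \<open>f = a\<^sup>0 + t p(t)\<close> and \<open>t = z - x\<close> the reduced function \<open>1/(a\<^sup>1 t) - 1/(f - a\<^sup>0)\<close> equals
  \<open>(1/a\<^sup>1 - 1/p(t)) / t\<close>, whose \<open>k\<close>-th coefficient is minus the coefficient \<open>k + 1\<close> of \<open>1/p\<close>.\<close>
definition reduced_coeffs :: "(nat \<Rightarrow> real) \<Rightarrow> nat \<Rightarrow> real" where
  "reduced_coeffs a k = - fps_nth (inverse (Abs_fps (\<lambda>i. a (Suc i)))) (Suc k)"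

section \<open>Factorization of Hankel matrices through power series inversion\<close>

lemma inverse_fps_convolution:
  fixes p :: "nat \<Rightarrow> real"
  assumes "p 0 \<noteq> 0" and "q = fps_nth (inverse (Abs_fps p))"
  shows "(\<Sum>i\<le>n. q i * p (n - i)) = (if n = 0 then 1 else 0)"
proof -
  have "inverse (Abs_fps p) * Abs_fps p = 1"
    using assms by (intro inverse_mult_eq_1) auto
  then have "fps_nth (inverse (Abs_fps p) * Abs_fps p) n = fps_nth 1 n"
    by simp
  then show ?thesis
    by (simp add: fps_mult_nth assms(2) atLeast0AtMost)
qed

text \<open>The Hankel kernel has the generating function
  \<open>(S p(S) - T p(T)) / (S - T)\<close>. Divided by \<open>p(S) p(T)\<close> it becomes
  \<open>(S q(T) - T q(S)) / (S - T)\<close> with \<open>q = 1/p\<close>, and the coefficients of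
  this quotient are \<open>D\<close>. The proof stays with one variable and treats the two indices
  in turn.\<close>

lemma inverse_fps_shift:
  fixes p :: "nat \<Rightarrow> real"
  assumes p0: "p 0 \<noteq> 0" and q: "q = fps_nth (inverse (Abs_fps p))"
  defines "D \<equiv> \<lambda>s l. if s = 0 \<and> l = 0 then q 0 else if s = 0 \<or> l = 0 then 0 else - q (s + l)"
  shows "p (i + j) = (\<Sum>l\<le>j. \<Sum>s\<le>i. p (i - s) * p (j - l) * D s l)"
proof -
  define E where "E l = (\<Sum>s\<le>i. p (i - s) * D s l)" for l
  \<comment> \<open>For fixed \<open>i\<close> the inner sum is a coefficient of \<open>q\<close>
    times the shifted series with coefficients \<open>p (i + t)\<close>; multiplication by
    \<open>p\<close> then returns the shifted series.\<close>
  have E: "E l = fps_nth (inverse (Abs_fps p) * Abs_fps (\<lambda>t. p (i + t))) l" for l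
  proof (cases l)
    case 0
    have "E 0 = (\<Sum>s\<le>i. if s = 0 then p i * q 0 else 0)"
      unfolding E_def D_def by (intro sum.cong) auto
    then show ?thesis using 0 q by (simp add: fps_mult_nth)
  next
    case (Suc l')
    have "E l = (\<Sum>s\<in>{1..i}. p (i - s) * D s l)"
      unfolding E_def by (rule sum.mono_neutral_right) (auto simp: D_def Suc)
    also have "\<dots> = - (\<Sum>s\<in>{1..i}. q (l + s) * p (i - s))"
      by (auto simp: D_def Suc sum_negf[symmetric] add.commute intro!: sum.cong)
    also have "(\<Sum>s\<in>{1..i}. q (l + s) * p (i - s)) = (\<Sum>t\<in>{l<..i+l}. q t * p (i + l - t))"
      by (rule sum.reindex_bij_witness[of _ "\<lambda>t. t - l" "\<lambda>s. l + s"]) (auto simp: algebra_simps)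
    finally have 1: "E l = - (\<Sum>t\<in>{l<..i+l}. q t * p (i + l - t))" .
    \<comment> \<open>The coefficient \<open>i + l\<close> of \<open>q p = 1\<close> vanishes
      because \<open>l > 0\<close>. Cut at index \<open>l\<close>, its upper part is
      \<open>- E l\<close> and its lower part is the coefficient wanted.\<close>
    have "(\<Sum>t\<le>i+l. q t * p (i + l - t)) = (\<Sum>t\<le>l. q t * p (i + l - t)) + (\<Sum>t\<in>{l<..i+l}. q t * p (i + l - t))"
      by (subst sum.union_disjoint[symmetric]) (auto intro!: sum.cong)
    moreover have "(\<Sum>t\<le>i+l. q t * p (i + l - t)) = 0"
      using inverse_fps_convolution[OF p0 q, of "i + l"] Suc by simp
    moreover have "(\<Sum>t\<le>l. q t * p (i + l - t)) = fps_nth (inverse (Abs_fps p) * Abs_fps (\<lambda>t. p (i + t))) l"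
      by (auto simp: fps_mult_nth q atLeast0AtMost intro!: sum.cong)
    ultimately show ?thesis using 1 by linarith
  qed
  have "inverse (Abs_fps p) * Abs_fps p = 1"
    using p0 by (intro inverse_mult_eq_1) auto
  moreover have "Abs_fps E = inverse (Abs_fps p) * Abs_fps (\<lambda>t. p (i + t))"
    by (rule fps_ext) (simp add: E)
  ultimately have "Abs_fps (\<lambda>t. p (i + t)) = Abs_fps E * Abs_fps p"
    by (simp only: mult.commute[of "inverse (Abs_fps p)"] mult.assoc mult_1_right)
  then have "p (i + j) = fps_nth (Abs_fps E * Abs_fps p) j"
    by (metis fps_nth_Abs_fps)
  also have "\<dots> = (\<Sum>l\<le>j. E l * p (j - l))"
    by (simp add: fps_mult_nth atLeast0AtMost)
  finally show ?thesis
    by (simp add: E_def sum_distrib_left mult_ac)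
qed

text \<open>Read from index \<open>k\<close> downwards, the upper triangular system is a product of
  power series truncated after degree \<open>k\<close>, so multiplication by \<open>1/p\<close>
  solves it. This supplies vectors \<open>t\<close> whose image \<open>w\<close> under the
  congruence is prescribed.\<close>

lemma triangular_toeplitz_surj:
  fixes p w :: "nat \<Rightarrow> real"
  assumes "p 0 \<noteq> 0"
  obtains t where "\<And>s. s \<le> k \<Longrightarrow> (\<Sum>j=s..k. p (j - s) * t j) = w s"
proof
  fix s assume s: "s \<le> k"
  define W where "W = Abs_fps (\<lambda>i. w (k - i))"
  let ?t = "\<lambda>j. fps_nth (inverse (Abs_fps p) * Abs_fps (\<lambda>i. w (k - i))) (k - j)"
  have inv: "inverse (Abs_fps p) * Abs_fps p = 1"
    using assms by (intro inverse_mult_eq_1) auto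
  have "(\<Sum>j=s..k. p (j - s) * ?t j) = (\<Sum>i=0..k - s. fps_nth (Abs_fps p) i * fps_nth (inverse (Abs_fps p) * W) (k - s - i))"
    unfolding W_def
    by (rule sum.reindex_bij_witness[of _ "\<lambda>i. i + s" "\<lambda>j. j - s"]) (use s in auto)
  also have "\<dots> = fps_nth (Abs_fps p * (inverse (Abs_fps p) * W)) (k - s)"
    by (simp add: fps_mult_nth)
  also have "Abs_fps p * (inverse (Abs_fps p) * W) = W"
    using inv by (metis mult.assoc mult.commute mult.right_neutral)
  finally show "(\<Sum>j=s..k. p (j - s) * ?t j) = w s"
    using s by (simp add: W_def)
qed

lemma sum_triangle_swap:
  fixes f :: "nat \<Rightarrow> nat \<Rightarrow> 'a :: comm_monoid_add"
  shows "(\<Sum>j\<le>k. \<Sum>l\<le>j. f j l) = (\<Sum>l\<le>k. \<Sum>j=l..k. f j l)"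
  by (simp add: sum.Sigma)
    (rule sum.reindex_bij_witness[of _ "\<lambda>(l, j). (j, l)" "\<lambda>(j, l). (l, j)"], auto)

text \<open>In matrix form, the infinite Hankel matrix of \<open>a\<close> is \<open>C (1/a\<^sup>1 \<oplus> N) C\<^sup>T\<close>, where \<open>C\<close> is lower
  triangular Toeplitz with first column \<open>a\<^sup>1, a\<^sup>2, \<dots>\<close> and \<open>N\<close> is the Hankel matrix of the reduced data;
  here \<open>w = C\<^sup>T t\<close> and \<open>R = (1/a\<^sup>1 \<oplus> N) w\<close>.\<close>
lemma hankel_row_reduction:
  fixes a t :: "nat \<Rightarrow> real" and k :: nat
  assumes a1: "a 1 \<noteq> 0"
  defines "w \<equiv> \<lambda>s. \<Sum>j=s..k. a (j - s + 1) * t j"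
  defines "R \<equiv> \<lambda>s. if s = 0 then w 0 / a 1 else \<Sum>l<k. reduced_coeffs a (s + l) * w (Suc l)"
  shows "(\<Sum>j\<le>k. a (i + j + 1) * t j) = (\<Sum>s\<le>i. a (i - s + 1) * R s)"
proof -
  define p where "p i = a (Suc i)" for i
  define q where "q = fps_nth (inverse (Abs_fps p))"
  define D where "D s l = (if s = 0 \<and> l = 0 then q 0 else if s = 0 \<or> l = 0 then 0 else - q (s + l))" for s l :: nat
  have p0: "p 0 \<noteq> 0" using a1 by (simp add: p_def)
  have pD: "p (i + j) = (\<Sum>l\<le>j. \<Sum>s\<le>i. p (i - s) * p (j - l) * D s l)" for j
    using inverse_fps_shift[OF p0 q_def] unfolding D_def .
  \<comment> \<open>\<open>D\<close> is block diagonal: its corner \<open>q 0\<close> is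
    \<open>1 / a 1\<close>, and for \<open>s > 0\<close> the entry \<open>- q (s + Suc l)\<close> is
    \<open>reduced_coeffs a (s + l)\<close>.\<close>
  have RD: "(\<Sum>l\<le>k. D s l * w l) = R s" for s
  proof (cases s)
    case 0
    have "(\<Sum>l\<le>k. D s l * w l) = (\<Sum>l\<le>k. if l = 0 then w 0 / a 1 else 0)"
      using 0 by (intro sum.cong) (auto simp: D_def q_def p_def field_simps)
    then show ?thesis using 0 by (simp add: R_def)
  next
    case (Suc s')
    have "(\<Sum>l\<le>k. D s l * w l) = (\<Sum>l\<in>{1..k}. D s l * w l)"
      by (rule sum.mono_neutral_right) (auto simp: D_def Suc)
    also have "\<dots> = (\<Sum>l<k. D s (Suc l) * w (Suc l))"
      by (rule sum.reindex_bij_witness[of _ Suc "\<lambda>l. l - 1"]) auto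
    also have "\<dots> = R s"
      unfolding R_def D_def Suc reduced_coeffs_def q_def p_def by (auto intro!: sum.cong)
    finally show ?thesis .
  qed
  have "(\<Sum>j\<le>k. a (i + j + 1) * t j) = (\<Sum>j\<le>k. \<Sum>l\<le>j. \<Sum>s\<le>i. p (i - s) * p (j - l) * D s l * t j)"
    using pD by (simp add: p_def sum_distrib_right)
  also have "\<dots> = (\<Sum>l\<le>k. \<Sum>j=l..k. \<Sum>s\<le>i. p (i - s) * p (j - l) * D s l * t j)"
    by (rule sum_triangle_swap)
  also have "\<dots> = (\<Sum>l\<le>k. \<Sum>s\<le>i. \<Sum>j=l..k. p (i - s) * p (j - l) * D s l * t j)"
    by (intro sum.cong refl sum.swap)
  also have "\<dots> = (\<Sum>s\<le>i. \<Sum>l\<le>k. \<Sum>j=l..k. p (i - s) * p (j - l) * D s l * t j)"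
    by (rule sum.swap)
  also have "\<dots> = (\<Sum>s\<le>i. p (i - s) * (\<Sum>l\<le>k. D s l * w l))"
    by (simp add: w_def sum_distrib_left p_def mult_ac)
  finally show ?thesis
    by (simp add: RD p_def)
qed

text \<open>\<open>t\<close> is the coefficient vector of a monic relation of order
  \<open>r\<close>; the rows \<open>i < N\<close> reach up to index \<open>N + r\<close>. Below,
  \<open>N\<close> is \<open>2 * m - 1 - r\<close> or \<open>2 * m - r\<close>, according to whether
  the relation ends at \<open>a (2 * m - 1)\<close> or at \<open>a (2 * m)\<close>.\<close>

definition recurrence :: "(nat \<Rightarrow> real) \<Rightarrow> nat \<Rightarrow> nat \<Rightarrow> bool" where
  "recurrence a N r \<longleftrightarrow> (\<exists>t. t r = 1 \<and> (\<forall>i<N. (\<Sum>j\<le>r. a (i + j + 1) * t j) = 0))"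

lemma recurrence_0: "recurrence a N 0 \<longleftrightarrow> (\<forall>i<N. a (Suc i) = 0)"
  unfolding recurrence_def by (auto intro: exI[of _ "\<lambda>_. 1"])

text \<open>By \<open>hankel_row_reduction\<close> the rows for \<open>a\<close> arise from
  \<open>R\<close> through a triangular matrix with diagonal \<open>a 1\<close>, so the first
  \<open>Suc N\<close> rows vanish exactly when \<open>R 0\<close>, ..., \<open>R N\<close> do. The
  equation \<open>R 0 = 0\<close> only fixes \<open>w 0\<close>, which costs one row and one
  unknown; the others form the recurrence for the reduced data.\<close>

lemma recurrence_reduction:
  assumes a1: "a 1 \<noteq> 0"
  shows "recurrence a (Suc N) (Suc r) \<longleftrightarrow> recurrence (reduced_coeffs a) N r"
proof
  assume "recurrence a (Suc N) (Suc r)"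
  then obtain t where t: "t (Suc r) = 1" "\<And>i. i < Suc N \<Longrightarrow> (\<Sum>j\<le>Suc r. a (i + j + 1) * t j) = 0"
    unfolding recurrence_def by blast
  define w where "w s = (\<Sum>j=s..Suc r. a (j - s + 1) * t j)" for s
  define R where "R s = (if s = 0 then w 0 / a 1 else \<Sum>l<Suc r. reduced_coeffs a (s + l) * w (Suc l))" for s
  have row: "(\<Sum>j\<le>Suc r. a (i + j + 1) * t j) = (\<Sum>s\<le>i. a (i - s + 1) * R s)" for i
    unfolding R_def w_def by (rule hankel_row_reduction[of a, OF a1])
  \<comment> \<open>Forward substitution: row \<open>s\<close> determines \<open>R s\<close> from
    the earlier values.\<close>
  have R0: "R s = 0" if "s \<le> N" for s
    using that
  proof (induction s rule: less_induct)
    case (less s)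
    have "0 = (\<Sum>s'\<le>s. a (s - s' + 1) * R s')"
      using t(2)[of s] less.prems row[of s] by (simp del: sum.atMost_Suc)
    also have "\<dots> = (\<Sum>s'<s. a (s - s' + 1) * R s') + a 1 * R s"
      by (simp add: lessThan_Suc_atMost[symmetric])
    also have "(\<Sum>s'<s. a (s - s' + 1) * R s') = 0"
      using less by (intro sum.neutral) auto
    finally show ?case using a1 by simp
  qed
  show "recurrence (reduced_coeffs a) N r"
    unfolding recurrence_def
  \<comment> \<open>The last component of \<open>w\<close> is \<open>a 1 * t (Suc r)\<close>;
    division by \<open>a 1\<close> makes the relation monic again.\<close>
  proof (intro exI[of _ "\<lambda>l. w (Suc l) / a 1"] conjI allI impI)
    show "w (Suc r) / a 1 = 1" using a1 t(1) by (simp add: w_def)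
    fix i assume "i < N"
    then show "(\<Sum>j\<le>r. reduced_coeffs a (i + j + 1) * (w (Suc j) / a 1)) = 0"
      using R0[of "Suc i"] by (simp add: R_def lessThan_Suc_atMost sum_divide_distrib[symmetric] del: sum.lessThan_Suc)
  qed
next
  assume "recurrence (reduced_coeffs a) N r"
  then obtain u where u: "u r = 1" "\<And>i. i < N \<Longrightarrow> (\<Sum>j\<le>r. reduced_coeffs a (i + j + 1) * u j) = 0"
    unfolding recurrence_def by blast
  \<comment> \<open>Component 0 is prescribed as 0 so that \<open>R 0 = 0\<close>; the factor
    \<open>a 1\<close> gives \<open>t\<close> the leading coefficient 1.\<close>
  obtain t where t: "\<And>s. s \<le> Suc r \<Longrightarrow> (\<Sum>j=s..Suc r. a (j - s + 1) * t j) = (if s = 0 then 0 else a 1 * u (s - 1))"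
    using triangular_toeplitz_surj[of "\<lambda>i. a (i + 1)" "Suc r" "\<lambda>s. if s = 0 then 0 else a 1 * u (s - 1)"] a1
    by auto
  have "t (Suc r) = 1" using t[of "Suc r"] a1 u(1) by simp
  moreover have "(\<Sum>j\<le>Suc r. a (i + j + 1) * t j) = 0" if "i < Suc N" for i
  proof -
    have "(\<Sum>j\<le>Suc r. a (i + j + 1) * t j) = (\<Sum>s\<le>i. a (i - s + 1) *
        (if s = 0 then (\<Sum>j=0..Suc r. a (j - 0 + 1) * t j) / a 1
         else \<Sum>l<Suc r. reduced_coeffs a (s + l) * (\<Sum>j=Suc l..Suc r. a (j - Suc l + 1) * t j)))"
      by (rule hankel_row_reduction[of a, OF a1])
    also have "\<dots> = 0"
    proof (intro sum.neutral ballI)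
      fix s assume "s \<in> {..i}"
      then have s: "s \<le> N" using that by simp
      have "(\<Sum>l<Suc r. reduced_coeffs a (s + l) * (\<Sum>j=Suc l..Suc r. a (j - Suc l + 1) * t j)) =
        a 1 * (\<Sum>l\<le>r. reduced_coeffs a (s - 1 + l + 1) * u l)" if "s \<noteq> 0"
      proof -
        have "reduced_coeffs a (s + l) * (\<Sum>j=Suc l..Suc r. a (j - Suc l + 1) * t j) =
            a 1 * (reduced_coeffs a (s - 1 + l + 1) * u l)" if "l \<le> r" for l
          using t[of "Suc l"] that \<open>s \<noteq> 0\<close> by (simp del: sum.cl_ivl_Suc)
        then show ?thesis
          by (simp add: lessThan_Suc_atMost sum_distrib_left del: sum.cl_ivl_Suc sum.atMost_Suc sum.lessThan_Suc)
      qed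
      moreover have "(\<Sum>j=0..Suc r. a (j - 0 + 1) * t j) = 0"
        using t[of 0] by (simp del: sum.cl_ivl_Suc)
      moreover have "(\<Sum>l\<le>r. reduced_coeffs a (s - 1 + l + 1) * u l) = 0" if "s \<noteq> 0"
        using u(2)[of "s - 1"] s that by auto
      ultimately show "a (i - s + 1) *
        (if s = 0 then (\<Sum>j=0..Suc r. a (j - 0 + 1) * t j) / a 1
         else \<Sum>l<Suc r. reduced_coeffs a (s + l) * (\<Sum>j=Suc l..Suc r. a (j - Suc l + 1) * t j)) = 0"
        by (cases "s = 0") (simp_all only: if_True if_False simp_thms mult_zero_right div_0)
    qed
    finally show ?thesis .
  qed
  ultimately show "recurrence a (Suc N) (Suc r)"
    unfolding recurrence_def by blast
qed

section \<open>Quadratic forms of Hankel matrices\<close>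

definition hankel_form :: "nat \<Rightarrow> (nat \<Rightarrow> real) \<Rightarrow> (nat \<Rightarrow> real) \<Rightarrow> real" where
  "hankel_form k a v = (\<Sum>i<k. \<Sum>j<k. a (i + j + 1) * v i * v j)"

text \<open>Exchanging the summations moves the triangular factor from the rows onto
  \<open>t\<close>, where it produces \<open>w\<close> once more. What remains is the pairing of
  \<open>w\<close> with \<open>R\<close>, a block diagonal form.\<close>

lemma hankel_form_reduction:
  fixes a t :: "nat \<Rightarrow> real" and k :: nat
  assumes a1: "a 1 \<noteq> 0"
  defines "w \<equiv> \<lambda>s. \<Sum>j=s..k. a (j - s + 1) * t j"
  shows "hankel_form (Suc k) a t = (w 0)\<^sup>2 / a 1 + hankel_form k (reduced_coeffs a) (\<lambda>l. w (Suc l))"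
proof -
  define R where "R s = (if s = 0 then w 0 / a 1 else \<Sum>l<k. reduced_coeffs a (s + l) * w (Suc l))" for s
  have "hankel_form (Suc k) a t = (\<Sum>i\<le>k. t i * (\<Sum>j\<le>k. a (i + j + 1) * t j))"
    by (simp add: hankel_form_def lessThan_Suc_atMost sum_distrib_left mult_ac)
  also have "\<dots> = (\<Sum>i\<le>k. t i * (\<Sum>s\<le>i. a (i - s + 1) * R s))"
    unfolding R_def w_def by (subst hankel_row_reduction[of a, OF a1]) (rule refl)
  also have "\<dots> = (\<Sum>i\<le>k. \<Sum>s\<le>i. t i * (a (i - s + 1) * R s))"
    by (simp add: sum_distrib_left)
  also have "\<dots> = (\<Sum>s\<le>k. \<Sum>i=s..k. t i * (a (i - s + 1) * R s))"
    by (rule sum_triangle_swap)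
  also have "\<dots> = (\<Sum>s\<le>k. R s * w s)"
    by (simp add: w_def sum_distrib_left mult_ac)
  also have "\<dots> = R 0 * w 0 + (\<Sum>s<k. R (Suc s) * w (Suc s))"
    by (simp add: lessThan_Suc_atMost[symmetric] sum.lessThan_Suc_shift del: sum.lessThan_Suc)
  finally show ?thesis
    by (simp add: R_def hankel_form_def power2_eq_square sum_distrib_left sum_distrib_right mult_ac)
qed


definition hankel_pos :: "nat \<Rightarrow> (nat \<Rightarrow> real) \<Rightarrow> bool" where
  "hankel_pos k a \<longleftrightarrow> (\<forall>v. (\<exists>i<k. v i \<noteq> 0) \<longrightarrow> 0 < hankel_form k a v)"

text \<open>For \<open>m = 0\<close> the form is identically 0 while \<open>v (m - 1)\<close> is
  \<open>v 0\<close>, so the other two clauses would hold; \<open>0 < m\<close> excludes the empty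
  matrix.\<close>

definition hankel_SE_min :: "nat \<Rightarrow> (nat \<Rightarrow> real) \<Rightarrow> bool" where
  "hankel_SE_min m a \<longleftrightarrow> 0 < m \<and> (\<forall>v. 0 \<le> hankel_form m a v) \<and>
     (\<forall>\<epsilon>>0. \<exists>v. hankel_form m a v < \<epsilon> * (v (m - 1))\<^sup>2)"

lemma hankel_form_cong:
  assumes "\<And>i. i < k \<Longrightarrow> v i = w i"
  shows "hankel_form k a v = hankel_form k a w"
  unfolding hankel_form_def using assms by (intro sum.cong) auto

lemma hankel_form_unit:
  assumes "i < k"
  shows "hankel_form k a (\<lambda>j. if j = i then 1 else 0) = a (2 * i + 1)"
proof -
  have "hankel_form k a (\<lambda>j. if j = i then 1 else 0) =
      (\<Sum>i'<k. if i' = i then (\<Sum>j<k. if j = i then a (i' + j + 1) else 0) else 0)"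
    unfolding hankel_form_def by (intro sum.cong refl) (simp add: if_distrib cong: if_cong)
  then show ?thesis using assms by (simp add: mult_2)
qed

lemma hankel_pos_0: "hankel_pos 0 a"
  by (simp add: hankel_pos_def)

text \<open>The map from \<open>t\<close> to \<open>w\<close> is triangular with diagonal
  \<open>a 1\<close>. Vectors with \<open>w 0 = 0\<close> test the reduced form, and conversely
  \<open>w\<close> is nonzero for nonzero \<open>t\<close>.\<close>

lemma hankel_pos_Suc:
  "hankel_pos (Suc k) a \<longleftrightarrow> 0 < a 1 \<and> hankel_pos k (reduced_coeffs a)"
proof
  assume pos: "hankel_pos (Suc k) a"
  have "0 < hankel_form (Suc k) a (\<lambda>j. if j = 0 then 1 else 0)"
    using pos by (auto simp: hankel_pos_def intro!: exI[of _ 0])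
  then have a1: "0 < a 1" using hankel_form_unit[of 0 "Suc k" a] by simp
  have "0 < hankel_form k (reduced_coeffs a) u" if u: "i < k" "u i \<noteq> 0" for u i
  proof -
    obtain t where t: "\<And>s. s \<le> k \<Longrightarrow> (\<Sum>j=s..k. a (j - s + 1) * t j) = (if s = 0 then 0 else u (s - 1))"
      using triangular_toeplitz_surj[of "\<lambda>i. a (i + 1)" k "\<lambda>s. if s = 0 then 0 else u (s - 1)"] a1 by auto
    have "\<exists>i<Suc k. t i \<noteq> 0"
    proof (rule ccontr)
      assume "\<not> (\<exists>i<Suc k. t i \<noteq> 0)"
      then have "(\<Sum>j=Suc i..k. a (j - Suc i + 1) * t j) = 0"
        by (intro sum.neutral) auto
      then show False using t[of "Suc i"] u by simp
    qed
    then have "0 < hankel_form (Suc k) a t"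
      using pos by (simp add: hankel_pos_def)
    also have "\<dots> = hankel_form k (reduced_coeffs a) (\<lambda>l. \<Sum>j=Suc l..k. a (j - Suc l + 1) * t j)"
      using hankel_form_reduction[of a k t] a1 t[of 0] by simp
    also have "\<dots> = hankel_form k (reduced_coeffs a) u"
      by (rule hankel_form_cong) (subst t, auto)
    finally show ?thesis .
  qed
  then show "0 < a 1 \<and> hankel_pos k (reduced_coeffs a)"
    using a1 by (auto simp: hankel_pos_def)
next
  assume r: "0 < a 1 \<and> hankel_pos k (reduced_coeffs a)"
  have "0 < hankel_form (Suc k) a t" if ti: "i < Suc k" "t i \<noteq> 0" for t i
  proof -
    define w where "w s = (\<Sum>j=s..k. a (j - s + 1) * t j)" for s
    have form: "hankel_form (Suc k) a t = (w 0)\<^sup>2 / a 1 + hankel_form k (reduced_coeffs a) (\<lambda>l. w (Suc l))"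
      unfolding w_def using hankel_form_reduction[of a k t] r by simp
    have "\<exists>s\<le>k. w s \<noteq> 0"
    proof (rule ccontr)
      assume w0: "\<not> (\<exists>s\<le>k. w s \<noteq> 0)"
      \<comment> \<open>Back substitution, starting from the last index.\<close>
      have "t j = 0" if "j \<le> k" for j
        using that
      proof (induction "k - j" arbitrary: j rule: less_induct)
        case less
        have "0 = (\<Sum>j'=j..k. a (j' - j + 1) * t j')" using w0 less.prems by (auto simp: w_def)
        also have "\<dots> = a 1 * t j + (\<Sum>j'=Suc j..k. a (j' - j + 1) * t j')"
          using less.prems by (simp add: sum.atLeast_Suc_atMost)
        also have "(\<Sum>j'=Suc j..k. a (j' - j + 1) * t j') = 0"
          using less by (intro sum.neutral) auto
        finally show ?case using r by simp
      qed
      then show False using ti by auto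
    qed
    then obtain s where s: "s \<le> k" "w s \<noteq> 0" by blast
    show ?thesis
    proof (cases "\<exists>l<k. w (Suc l) \<noteq> 0")
      case True
      then have "0 < hankel_form k (reduced_coeffs a) (\<lambda>l. w (Suc l))"
        using r by (auto simp: hankel_pos_def)
      then show ?thesis using form r by (simp add: add_nonneg_pos)
    next
      case False
      then have "hankel_form k (reduced_coeffs a) (\<lambda>l. w (Suc l)) = hankel_form k (reduced_coeffs a) (\<lambda>_. 0)"
        by (intro hankel_form_cong) auto
      moreover have "w 0 \<noteq> 0" using False s by (cases s) auto
      ultimately show ?thesis using form r by (simp add: hankel_form_def)
    qed
  qed
  then show "hankel_pos (Suc k) a"
    by (auto simp: hankel_pos_def)
qed

text \<open>Since the last component of \<open>w\<close> is \<open>a 1 * t m\<close>, lowering the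
  southeast corner by \<open>\<epsilon>\<close> corresponds to lowering that of the reduced matrix
  by \<open>\<epsilon> / (a 1)\<^sup>2\<close>.\<close>

lemma hankel_SE_min_Suc:
  assumes a1: "0 < a 1"
  shows "hankel_SE_min (Suc m) a \<longleftrightarrow> hankel_SE_min m (reduced_coeffs a)"
proof -
  define w where "w t s = (\<Sum>j=s..m. a (j - s + 1) * t j)" for t s
  have form: "hankel_form (Suc m) a t = (w t 0)\<^sup>2 / a 1 + hankel_form m (reduced_coeffs a) (\<lambda>l. w t (Suc l))" for t
    unfolding w_def using hankel_form_reduction[of a m t] a1 by simp
  have last: "w t m = a 1 * t m" for t by (simp add: w_def)
  have surj: "\<exists>t. \<forall>s\<le>m. w t s = (if s = 0 then 0 else u (s - 1))" for u
  proof -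
    obtain t where "\<And>s. s \<le> m \<Longrightarrow> (\<Sum>j=s..m. a (j - s + 1) * t j) = (if s = 0 then 0 else u (s - 1))"
      using triangular_toeplitz_surj[of "\<lambda>i. a (i + 1)" m "\<lambda>s. if s = 0 then 0 else u (s - 1)"] a1 by auto
    then show ?thesis unfolding w_def by blast
  qed
  have lift: "\<exists>t. hankel_form (Suc m) a t = hankel_form m (reduced_coeffs a) u \<and> (0 < m \<longrightarrow> a 1 * t m = u (m - 1))" for u
  proof -
    obtain t where t: "\<And>s. s \<le> m \<Longrightarrow> w t s = (if s = 0 then 0 else u (s - 1))"
      using surj by blast
    have "hankel_form m (reduced_coeffs a) (\<lambda>l. w t (Suc l)) = hankel_form m (reduced_coeffs a) u"
      by (rule hankel_form_cong) (simp add: t)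
    then show ?thesis using t[of m] t[of 0] last[of t] form[of t] by auto
  qed
  show ?thesis
  proof
    assume min: "hankel_SE_min (Suc m) a"
    \<comment> \<open>The 1 x 1 matrix with entry \<open>a 1 > 0\<close> is not SE-minimal: after
      subtraction of \<open>a 1\<close> it is still positive semidefinite.\<close>
    have "0 < m"
    proof (rule ccontr)
      assume "\<not> 0 < m"
      then have "m = 0" by simp
      obtain v where "hankel_form 1 a v < a 1 * (v 0)\<^sup>2"
        using min a1 \<open>m = 0\<close> unfolding hankel_SE_min_def by auto
      then show False by (simp add: hankel_form_def power2_eq_square mult_ac)
    qed
    moreover have "0 \<le> hankel_form m (reduced_coeffs a) u" for u
      using lift[of u] min unfolding hankel_SE_min_def by metis
    moreover have "\<exists>v. hankel_form m (reduced_coeffs a) v < \<epsilon> * (v (m - 1))\<^sup>2" if "0 < \<epsilon>" for \<epsilon>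
    proof -
      have "0 < \<epsilon> * (a 1)\<^sup>2" using that a1 by simp
      then obtain t where t: "hankel_form (Suc m) a t < \<epsilon> * (a 1)\<^sup>2 * (t m)\<^sup>2"
        using min unfolding hankel_SE_min_def by auto
      \<comment> \<open>Dropping the square of \<open>w 0\<close> can only lower the form.\<close>
      have "hankel_form m (reduced_coeffs a) (\<lambda>l. w t (Suc l)) \<le> hankel_form (Suc m) a t"
        using form[of t] a1 by simp
      also note t
      also have "\<epsilon> * (a 1)\<^sup>2 * (t m)\<^sup>2 = \<epsilon> * (w t (Suc (m - 1)))\<^sup>2"
        using last[of t] \<open>0 < m\<close> by (simp add: power_mult_distrib)
      finally show ?thesis by blast
    qed
    ultimately show "hankel_SE_min m (reduced_coeffs a)"
      by (auto simp: hankel_SE_min_def)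
  next
    assume min: "hankel_SE_min m (reduced_coeffs a)"
    have "0 \<le> hankel_form (Suc m) a t" for t
      using form[of t] min a1 by (simp add: hankel_SE_min_def)
    moreover have "\<exists>v. hankel_form (Suc m) a v < \<epsilon> * (v m)\<^sup>2" if "0 < \<epsilon>" for \<epsilon>
    proof -
      have "0 < \<epsilon> / (a 1)\<^sup>2" using that a1 by simp
      then obtain u where u: "hankel_form m (reduced_coeffs a) u < \<epsilon> / (a 1)\<^sup>2 * (u (m - 1))\<^sup>2"
        using min unfolding hankel_SE_min_def by blast
      obtain t where t: "hankel_form (Suc m) a t = hankel_form m (reduced_coeffs a) u" "u (m - 1) = a 1 * t m"
        using lift[of u] min unfolding hankel_SE_min_def by metis
      have "\<epsilon> / (a 1)\<^sup>2 * (u (m - 1))\<^sup>2 = \<epsilon> * (t m)\<^sup>2"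
        unfolding t(2) using a1 by (simp add: power_mult_distrib)
      then have "hankel_form (Suc m) a t < \<epsilon> * (t m)\<^sup>2"
        using u t(1) by linarith
      then show ?thesis by blast
    qed
    ultimately show "hankel_SE_min (Suc m) a"
      by (auto simp: hankel_SE_min_def)
  qed
qed

lemma affine_nonneg_imp_zero:
  fixes c d :: real
  assumes "\<And>s. 0 \<le> 2 * s * c + d"
  shows "c = 0"
proof (rule ccontr)
  assume "c \<noteq> 0"
  then have "2 * (- (d + 1) / (2 * c)) * c = - (d + 1)"
    by (simp add: divide_simps)
  then show False
    using assms[of "- (d + 1) / (2 * c)"] by linarith
qed

text \<open>At the vector with \<open>s\<close> in position \<open>i\<close> and 1 in position
  \<open>j\<close> the form is affine in \<open>s\<close>, because the diagonal entry multiplying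
  the square of \<open>s\<close> is 0. Being nonnegative for all \<open>s\<close>, it has slope
  0.\<close>

lemma hankel_nonneg_zero_row:
  assumes nonneg: "\<And>v. 0 \<le> hankel_form m a v" and ij: "i < m" "j < m" and diag: "a (2 * i + 1) = 0"
  shows "a (i + j + 1) = 0"
proof (cases "i = j")
  case False
  have "0 \<le> 2 * s * a (i + j + 1) + a (2 * j + 1)" for s
  proof -
    define v where "v k = (if k = i then s else if k = j then 1 else 0)" for k
    have row: "(\<Sum>l<m. a (k + l + 1) * v k * v l) = v k * (s * a (k + i + 1) + a (k + j + 1))" for k
    proof -
      have "(\<Sum>l<m. a (k + l + 1) * v k * v l) = (\<Sum>l\<in>{i, j}. a (k + l + 1) * v k * v l)"
        using ij by (intro sum.mono_neutral_right) (auto simp: v_def)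
      then show ?thesis using False by (simp add: v_def algebra_simps)
    qed
    have "hankel_form m a v = (\<Sum>k\<in>{i, j}. v k * (s * a (k + i + 1) + a (k + j + 1)))"
      unfolding hankel_form_def row using ij by (intro sum.mono_neutral_right) (auto simp: v_def)
    also have "\<dots> = 2 * s * a (i + j + 1) + a (2 * j + 1)"
    proof -
      have "v i = s" "v j = 1" using False by (auto simp: v_def)
      moreover have "a (j + i + 1) = a (i + j + 1)" by (simp only: add.commute)
      moreover have "a (i + i + 1) = 0" "a (j + j + 1) = a (2 * j + 1)"
        using diag by (simp_all only: mult_2)
      ultimately show ?thesis
        using False by simp
    qed
    finally show ?thesis using nonneg[of v] by simp
  qed
  then show ?thesis by (rule affine_nonneg_imp_zero)
next
  case True
  then show ?thesis using diag by (simp only: mult_2)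
qed

text \<open>A zero in the northwest corner spreads along the diagonal and clears every entry except
  the southeast corner, which minimality clears.\<close>

lemma hankel_SE_min_zero:
  assumes min: "hankel_SE_min m a" and a1: "a 1 = 0" and i: "i < 2 * m - 1"
  shows "a (Suc i) = 0"
proof -
  have nonneg: "0 \<le> hankel_form m a v" for v
    using min by (simp add: hankel_SE_min_def)
  \<comment> \<open>The zero row \<open>i\<close> contains the entry \<open>(i, i + 2)\<close>,
    which lies on the antidiagonal of the diagonal entry \<open>i + 1\<close>. The last diagonal
    entry is out of reach, hence \<open>i + 1 < m\<close>.\<close>
  have diag: "a (2 * i + 1) = 0" if "i + 1 < m" for i
    using that
  proof (induction i)
    case (Suc i)
    then have "a (i + (i + 2) + 1) = 0"
      by (intro hankel_nonneg_zero_row[OF nonneg]) auto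
    then show ?case by (simp add: mult_2)
  qed (use a1 in simp)
  have zero: "a (i + j + 1) = 0" if "i < m" "j < m" "i + j + 2 < 2 * m" for i j
  proof (cases "i + 1 < m")
    case True
    then show ?thesis using that diag by (intro hankel_nonneg_zero_row[OF nonneg]) auto
  next
    case False
    then have "a (j + i + 1) = 0"
      using that diag by (intro hankel_nonneg_zero_row[OF nonneg]) auto
    then show ?thesis by (simp add: add.commute)
  qed
  have form: "hankel_form m a v = a (2 * m - 1) * (v (m - 1))\<^sup>2" for v
  proof -
    have "a (i + j + 1) * v i * v j = (if j = m - 1 then if i = m - 1 then a (2 * m - 1) * (v (m - 1))\<^sup>2 else 0 else 0)"
      if "i < m" "j < m" for i j
    proof (cases "i = m - 1 \<and> j = m - 1")
      case True
      then have "i + j + 1 = 2 * m - 1" using that by simp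
      then have "a (i + j + 1) = a (2 * m - 1)" by (rule arg_cong)
      then show ?thesis using True by (simp only: if_True simp_thms power2_eq_square mult.assoc)
    next
      case False
      then have "i + j + 2 < 2 * m" using that by auto
      then show ?thesis using zero[OF that] False by (simp only:) auto
    qed
    then have "hankel_form m a v = (\<Sum>i<m. \<Sum>j<m. if j = m - 1 then if i = m - 1 then a (2 * m - 1) * (v (m - 1))\<^sup>2 else 0 else 0)"
      unfolding hankel_form_def by (intro sum.cong refl) auto
    also have "\<dots> = a (2 * m - 1) * (v (m - 1))\<^sup>2"
      using min by (simp add: hankel_SE_min_def)
    finally show ?thesis .
  qed
  have "0 \<le> a (2 * m - 1)"
    using nonneg[of "\<lambda>_. 1"] form[of "\<lambda>_. 1"] by simp
  \<comment> \<open>Otherwise this entry itself would be an \<open>\<epsilon>\<close> that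
    contradicts minimality.\<close>
  moreover have "\<not> 0 < a (2 * m - 1)"
    using min form unfolding hankel_SE_min_def by (metis less_irrefl)
  ultimately have last: "a (2 * m - 1) = 0" by simp
  show ?thesis
  proof (cases "i = 2 * m - 2")
    case True
    then have "Suc i = 2 * m - 1" using i by simp
    then show ?thesis using last by simp
  next
    case False
    show ?thesis
    proof (cases "i < m")
      case True
      then show ?thesis using zero[of i 0] i False by simp
    next
      case ge: False
      then show ?thesis using zero[of "m - 1" "i - (m - 1)"] i False by simp
    qed
  qed
qed

text \<open>While \<open>a 1 > 0\<close>, each reduction lowers \<open>m\<close>, \<open>r\<close>
  and the number of rows \<open>2 * m - 1 - r\<close> by one. When \<open>a 1 = 0\<close>, only
  \<open>r = 0\<close> is possible, and the recurrence then says that all entries of the matrix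
  vanish.\<close>

lemma hankel_SE_min_iff:
  "hankel_SE_min m a \<longleftrightarrow> (\<exists>r<m. hankel_pos r a \<and> recurrence a (2 * m - 1 - r) r)"
proof (induction m arbitrary: a)
  case 0
  then show ?case by (simp add: hankel_SE_min_def)
next
  case (Suc m)
  show ?case
  proof (cases "0 < a 1")
    case True
    have "(\<exists>r<Suc m. hankel_pos r a \<and> recurrence a (2 * Suc m - 1 - r) r) \<longleftrightarrow>
        (\<exists>r<m. hankel_pos (Suc r) a \<and> recurrence a (2 * Suc m - 1 - Suc r) (Suc r))"
    proof (intro iffI; elim exE conjE)
      fix r assume r: "r < Suc m" "hankel_pos r a" "recurrence a (2 * Suc m - 1 - r) r"
      moreover have "r \<noteq> 0"
      proof
        assume "r = 0"
        then have "a (Suc 0) = 0" using r(3) by (simp add: recurrence_0)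
        then show False using True by simp
      qed
      ultimately show "\<exists>r<m. hankel_pos (Suc r) a \<and> recurrence a (2 * Suc m - 1 - Suc r) (Suc r)"
        by (metis Suc_less_SucD not0_implies_Suc)
    qed blast
    also have "\<dots> \<longleftrightarrow> (\<exists>r<m. hankel_pos r (reduced_coeffs a) \<and> recurrence (reduced_coeffs a) (2 * m - 1 - r) r)"
    proof (intro ex_cong1 conj_cong refl)
      fix r assume "r < m"
      then have "2 * Suc m - 1 - Suc r = Suc (2 * m - 1 - r)" by simp
      then show "recurrence a (2 * Suc m - 1 - Suc r) (Suc r) \<longleftrightarrow> recurrence (reduced_coeffs a) (2 * m - 1 - r) r"
        using True recurrence_reduction by simp
    qed (use True hankel_pos_Suc in simp)
    finally show ?thesis
      using hankel_SE_min_Suc[of a, OF True] Suc.IH by simp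
  next
    case False
    show ?thesis
    proof
      assume min: "hankel_SE_min (Suc m) a"
      then have "0 \<le> hankel_form (Suc m) a (\<lambda>j. if j = 0 then 1 else 0)"
        by (simp add: hankel_SE_min_def)
      then have "a 1 = 0" using False hankel_form_unit[of 0 "Suc m" a] by simp
      then have "recurrence a (2 * Suc m - 1 - 0) 0"
        using hankel_SE_min_zero[OF min] by (simp add: recurrence_0)
      then show "\<exists>r<Suc m. hankel_pos r a \<and> recurrence a (2 * Suc m - 1 - r) r"
        using hankel_pos_0 by blast
    next
      assume "\<exists>r<Suc m. hankel_pos r a \<and> recurrence a (2 * Suc m - 1 - r) r"
      then obtain r where r: "hankel_pos r a" "recurrence a (2 * Suc m - 1 - r) r" by blast
      then have "r = 0" using False hankel_pos_Suc by (cases r) auto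
      then have "a (Suc i) = 0" if "i < 2 * Suc m - 1" for i
        using r(2) that by (simp add: recurrence_0)
      then have form: "hankel_form (Suc m) a v = 0" for v
        unfolding hankel_form_def by (intro sum.neutral ballI) auto
      show "hankel_SE_min (Suc m) a"
        unfolding hankel_SE_min_def form
        by (auto intro!: exI[of _ "\<lambda>_. 1"])
    qed
  qed
qed

section \<open>Rank and inverse of degenerate Hankel matrices\<close>

text \<open>Repeated use of the relation expresses column \<open>r + k\<close> through the first
  \<open>r\<close> columns. In the rows \<open>i + k < N\<close> this is exact; in the first row
  where the relation may fail, the defect \<open>L N\<close> is carried along with coefficient 1
  because \<open>t\<close> is monic. The exact rows give the rank, the defect row gives the
  condition on \<open>a (2 * m)\<close>.\<close>

lemma recurrence_extend:
  fixes a t :: "nat \<Rightarrow> real" and r k N :: nat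
  defines "L \<equiv> \<lambda>i. \<Sum>j\<le>r. a (i + j + 1) * t j"
  assumes t: "t r = 1" and L0: "\<And>i. i < N \<Longrightarrow> L i = 0"
  shows "\<exists>u. (\<forall>i. i + k < N \<longrightarrow> a (i + r + k + 1) = (\<Sum>j<r. a (i + j + 1) * u j)) \<and>
             (\<forall>i. i + k = N \<longrightarrow> a (i + r + k + 1) = (\<Sum>j<r. a (i + j + 1) * u j) + L N)"
proof (induction k)
  case 0
  have "a (i + r + 1) = (\<Sum>j<r. a (i + j + 1) * (- t j)) + L i" for i
    using t by (simp add: L_def lessThan_Suc_atMost[symmetric] sum_negf)
  then show ?case
    using L0 by (intro exI[of _ "\<lambda>j. - t j"]) auto
next
  case (Suc k)
  then obtain u where
    u: "\<And>i. i + k < N \<Longrightarrow> a (i + r + k + 1) = (\<Sum>j<r. a (i + j + 1) * u j)"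
       "\<And>i. i + k = N \<Longrightarrow> a (i + r + k + 1) = (\<Sum>j<r. a (i + j + 1) * u j) + L N"
    by blast
  \<comment> \<open>Moving one column to the right shifts \<open>u\<close>; the entry that lands on
    column \<open>r\<close> is eliminated by the relation.\<close>
  define u' where "u' j = (if j = 0 then 0 else u (j - 1)) - (if r = 0 then 0 else u (r - 1) * t j)" for j
  have shift: "(\<Sum>j<r. a (Suc i + j + 1) * u j) = (\<Sum>j<r. a (i + j + 1) * u' j)" if "i < N" for i
  proof (cases r)
    case (Suc r')
    have "a (i + r + 1) = - (\<Sum>j<r. a (i + j + 1) * t j)"
      using L0[OF that] t by (simp add: L_def lessThan_Suc_atMost[symmetric])
    moreover have "(\<Sum>j<r. a (Suc i + j + 1) * u j) = (\<Sum>j<r'. a (i + Suc j + 1) * u j) + a (i + r + 1) * u r'"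
      by (simp add: Suc)
    moreover have "(\<Sum>j<r'. a (i + Suc j + 1) * u j) = (\<Sum>j<r. a (i + j + 1) * (if j = 0 then 0 else u (j - 1)))"
      by (simp only: Suc sum.lessThan_Suc_shift) simp
    moreover have "(\<Sum>j<r. a (i + j + 1) * u' j) =
        (\<Sum>j<r. a (i + j + 1) * (if j = 0 then 0 else u (j - 1))) - (\<Sum>j<r. a (i + j + 1) * t j) * u r'"
      by (simp add: u'_def Suc sum_subtractf right_diff_distrib sum_distrib_left mult_ac del: sum.lessThan_Suc)
    ultimately show ?thesis by simp
  qed simp
  show ?case
  proof (intro exI[of _ u'] conjI allI impI)
    fix i
    show "a (i + r + Suc k + 1) = (\<Sum>j<r. a (i + j + 1) * u' j)" if "i + Suc k < N"
      using u(1)[of "Suc i"] shift[of i] that by simp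
    show "a (i + r + Suc k + 1) = (\<Sum>j<r. a (i + j + 1) * u' j) + L N" if "i + Suc k = N"
      using u(2)[of "Suc i"] shift[of i] that by simp
  qed
qed

section \<open>Matrices, their quadratic forms, rank and inverse\<close>

lemma hankel_carrier: "hankel k a \<in> carrier_mat k k"
  by (simp add: hankel_def)

lemma hankel_mult_vec_index:
  assumes "v \<in> carrier_vec k" "i < k"
  shows "(hankel k a *\<^sub>v v) $ i = (\<Sum>j<k. a (i + j + 1) * v $ j)"
  using assms by (simp add: hankel_def scalar_prod_def atLeast0LessThan)

lemma scalar_prod_hankel:
  assumes v: "v \<in> carrier_vec k"
  shows "v \<bullet> (hankel k a *\<^sub>v v) = hankel_form k a (\<lambda>i. v $ i)"
proof -
  have "v \<bullet> (hankel k a *\<^sub>v v) = (\<Sum>i<k. v $ i * (hankel k a *\<^sub>v v) $ i)"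
    using v hankel_carrier[of k a] by (simp add: scalar_prod_def atLeast0LessThan del: index_mult_mat_vec)
  also have "\<dots> = (\<Sum>i<k. v $ i * (\<Sum>j<k. a (i + j + 1) * v $ j))"
    using hankel_mult_vec_index[OF v] by (intro sum.cong) auto
  finally show ?thesis
    by (simp add: hankel_form_def sum_distrib_left mult_ac)
qed

lemma transpose_hankel: "(hankel k a)\<^sup>T = hankel k a"
  by (rule eq_matI) (auto simp: hankel_def add.commute)

lemma square_hankel: "square_mat (hankel k a)"
  by (simp add: hankel_def)

lemma pos_definite_hankel: "pos_definite (hankel k a) \<longleftrightarrow> hankel_pos k a"
proof
  assume pd: "pos_definite (hankel k a)"
  show "hankel_pos k a"
    unfolding hankel_pos_def
  proof (intro allI impI)
    fix v :: "nat \<Rightarrow> real" assume "\<exists>i<k. v i \<noteq> 0"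
    then have "Matrix.vec k v \<noteq> 0\<^sub>v k"
      by (metis index_vec index_zero_vec(1))
    then have "0 < hankel_form k a (\<lambda>i. Matrix.vec k v $ i)"
      using pd hankel_carrier[of k a] by (auto simp: pos_definite_def simp flip: scalar_prod_hankel)
    also have "\<dots> = hankel_form k a v" by (rule hankel_form_cong) simp
    finally show "0 < hankel_form k a v" .
  qed
next
  assume pos: "hankel_pos k a"
  have "\<exists>i<k. v $ i \<noteq> 0" if "v \<in> carrier_vec k" "v \<noteq> 0\<^sub>v k" for v :: "real vec"
    using that by (metis carrier_vecD eq_vecI index_zero_vec)
  then show "pos_definite (hankel k a)"
    using pos hankel_carrier[of k a]
    by (auto simp: pos_definite_def transpose_hankel square_hankel scalar_prod_hankel hankel_pos_def)
qed

lemma SE_minimally_positive_hankel: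
  assumes "0 < m"
  shows "SE_minimally_positive m (hankel m a) \<longleftrightarrow> hankel_SE_min m a"
proof -
  define E where "E \<epsilon> = mat_diag m (\<lambda>i. if i = m - 1 then \<epsilon> else (0::real))" for \<epsilon>
  have E: "E \<epsilon> \<in> carrier_mat m m" for \<epsilon> by (simp add: E_def)
  have form: "v \<bullet> ((hankel m a - E \<epsilon>) *\<^sub>v v) = hankel_form m a (\<lambda>i. v $ i) - \<epsilon> * (v $ (m - 1))\<^sup>2"
    if v: "v \<in> carrier_vec m" for v \<epsilon>
  proof -
    have "(E \<epsilon> *\<^sub>v v) $ i = (if i = m - 1 then \<epsilon> * v $ (m - 1) else 0)" if "i < m" for i
    proof -
      have "(E \<epsilon> *\<^sub>v v) $ i = (\<Sum>j<m. E \<epsilon> $$ (i, j) * v $ j)"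
        using that v E[of \<epsilon>] by (simp add: scalar_prod_def atLeast0LessThan)
      also have "\<dots> = (\<Sum>j<m. if j = i then (if i = m - 1 then \<epsilon> * v $ i else 0) else 0)"
        using that by (intro sum.cong) (auto simp: E_def mat_diag_def)
      finally have "(E \<epsilon> *\<^sub>v v) $ i = (\<Sum>j<m. if j = i then (if i = m - 1 then \<epsilon> * v $ i else 0) else 0)" .
      then show ?thesis using that by auto
    qed
    then have "v \<bullet> (E \<epsilon> *\<^sub>v v) = (\<Sum>i<m. if i = m - 1 then \<epsilon> * (v $ (m - 1))\<^sup>2 else 0)"
      using v E[of \<epsilon>]
      by (simp only: scalar_prod_def atLeast0LessThan dim_mult_mat_vec carrier_matD)
        (intro sum.cong, auto simp: power2_eq_square)
    also have "\<dots> = \<epsilon> * (v $ (m - 1))\<^sup>2" using assms by simp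
    finally have "v \<bullet> (E \<epsilon> *\<^sub>v v) = \<epsilon> * (v $ (m - 1))\<^sup>2" .
    moreover have "v \<bullet> ((hankel m a - E \<epsilon>) *\<^sub>v v) = v \<bullet> (hankel m a *\<^sub>v v) - v \<bullet> (E \<epsilon> *\<^sub>v v)"
      using v E[of \<epsilon>] hankel_carrier[of m a]
      by (simp add: minus_mult_distrib_mat_vec scalar_prod_minus_distrib[of _ m])
    ultimately show ?thesis using scalar_prod_hankel[OF v] by simp
  qed
  have vec_form: "hankel_form m a (\<lambda>i. Matrix.vec m v $ i) = hankel_form m a v" for v
    by (rule hankel_form_cong) simp
  \<comment> \<open>The forms see only the entries below \<open>m\<close>, so quantifying over
    vectors or over functions is the same.\<close>
  have all: "(\<forall>v\<in>carrier_vec m. P (\<lambda>i. v $ i)) \<longleftrightarrow> (\<forall>v. P v)"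
    if "\<And>v w. (\<And>i. i < m \<Longrightarrow> v i = w i) \<Longrightarrow> P v = P w" for P :: "(nat \<Rightarrow> real) \<Rightarrow> bool"
  proof (intro iffI allI)
    fix v assume "\<forall>v\<in>carrier_vec m. P (\<lambda>i. v $ i)"
    then have "P (\<lambda>i. Matrix.vec m v $ i)" by auto
    moreover have "P (\<lambda>i. Matrix.vec m v $ i) = P v" by (rule that) simp
    ultimately show "P v" by simp
  qed auto
  have "pos_semidefinite (hankel m a) \<longleftrightarrow> (\<forall>v\<in>carrier_vec m. 0 \<le> hankel_form m a (\<lambda>i. v $ i))"
    using hankel_carrier[of m a]
    by (auto simp: pos_semidefinite_def transpose_hankel square_hankel scalar_prod_hankel)
  also have "\<dots> \<longleftrightarrow> (\<forall>v. 0 \<le> hankel_form m a v)"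
    by (rule all) (metis hankel_form_cong)
  finally have psd: "pos_semidefinite (hankel m a) \<longleftrightarrow> (\<forall>v. 0 \<le> hankel_form m a v)" .
  have psdE: "pos_semidefinite (hankel m a - E \<epsilon>) \<longleftrightarrow> (\<forall>v. 0 \<le> hankel_form m a v - \<epsilon> * (v (m - 1))\<^sup>2)" for \<epsilon>
  proof -
    have "(hankel m a - E \<epsilon>)\<^sup>T = hankel m a - E \<epsilon>"
      by (rule eq_matI) (auto simp: hankel_def E_def mat_diag_def add.commute)
    moreover have "square_mat (hankel m a - E \<epsilon>)" "dim_row (hankel m a - E \<epsilon>) = m"
      using E[of \<epsilon>] by auto
    ultimately have "pos_semidefinite (hankel m a - E \<epsilon>) \<longleftrightarrow>
        (\<forall>v\<in>carrier_vec m. 0 \<le> hankel_form m a (\<lambda>i. v $ i) - \<epsilon> * (v $ (m - 1))\<^sup>2)"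
      using form by (simp add: pos_semidefinite_def)
    also have "\<dots> \<longleftrightarrow> (\<forall>v. 0 \<le> hankel_form m a v - \<epsilon> * (v (m - 1))\<^sup>2)"
    proof (rule all)
      fix v w :: "nat \<Rightarrow> real" assume "\<And>i. i < m \<Longrightarrow> v i = w i"
      then show "(0 \<le> hankel_form m a v - \<epsilon> * (v (m - 1))\<^sup>2) = (0 \<le> hankel_form m a w - \<epsilon> * (w (m - 1))\<^sup>2)"
        using hankel_form_cong[of m v w a] assms by simp
    qed
    finally show ?thesis .
  qed
  show ?thesis
    using assms psdE unfolding SE_minimally_positive_def hankel_SE_min_def psd E_def
    by (simp add: not_le)
qed

text \<open>The first \<open>r\<close> columns are a basis of the column space: their upper block is
  the positive definite \<open>hankel r a\<close>, which makes them independent, and the recurrence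
  generates the other columns from them.\<close>

lemma rank_hankel:
  assumes pos: "hankel_pos r a" and rm: "r < m" and rec: "recurrence a (2 * m - 1 - r) r"
  shows "vec_space.rank m (hankel m a) = r"
proof -
  interpret vec_space "TYPE(real)" m .
  define A where "A = Matrix.mat m r (\<lambda>(i, j). a (i + j + 1))"
  have A: "A \<in> carrier_mat m r" by (simp add: A_def)
  have kernel: "v = 0\<^sub>v r" if v: "v \<in> carrier_vec r" and "A *\<^sub>v v = 0\<^sub>v m" for v
  proof (rule ccontr)
    assume "v \<noteq> 0\<^sub>v r"
    then have "\<exists>i<r. v $ i \<noteq> 0" using v by (metis carrier_vecD eq_vecI index_zero_vec)
    then have "0 < hankel_form r a (\<lambda>i. v $ i)" using pos by (simp add: hankel_pos_def)
    also have "\<dots> = (\<Sum>i<r. v $ i * (\<Sum>j<r. a (i + j + 1) * v $ j))"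
      by (simp add: hankel_form_def sum_distrib_left mult_ac)
    also have "\<dots> = (\<Sum>i<r. v $ i * (A *\<^sub>v v) $ i)"
      using rm v by (intro sum.cong refl) (auto simp: A_def scalar_prod_def atLeast0LessThan)
    also have "\<dots> = 0" using that rm by simp
    finally show False by simp
  qed
  have unit: "A *\<^sub>v unit_vec r j = col A j" if "j < r" for j
    using A that by (intro eq_vecI) (auto simp: scalar_prod_right_unit)
  \<comment> \<open>Span and dependence below refer to the set of columns, in which a repeated
    column would be lost.\<close>
  have dist: "distinct (cols A)"
  proof (rule ccontr)
    assume "\<not> distinct (cols A)"
    then obtain i j where ij: "i < r" "j < r" "i \<noteq> j" "col A i = col A j"
      using A by (auto simp: distinct_conv_nth)
    have "A *\<^sub>v (unit_vec r i - unit_vec r j) = A *\<^sub>v unit_vec r i - A *\<^sub>v unit_vec r j"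
      using A by (intro mult_minus_distrib_mat_vec) auto
    also have "\<dots> = col A i - col A j"
      using A ij by (simp add: unit)
    also have "\<dots> = 0\<^sub>v m" using ij A by (simp add: A_def)
    finally have "unit_vec r i - unit_vec r j = (0\<^sub>v r :: real vec)"
      by (intro kernel) auto
    then have "(unit_vec r i - unit_vec r j) $ i = (0\<^sub>v r :: real vec) $ i" by simp
    then show False using ij by simp
  qed
  have indpt: "lin_indpt (set (cols A))"
    using kernel lin_depE[OF A _ dist] by blast
  have colsA: "set (cols A) \<subseteq> carrier_vec m" using A cols_dim by (metis carrier_matD(1))
  have colsH: "set (cols (hankel m a)) \<subseteq> carrier_vec m"
    using hankel_carrier[of m a] cols_dim by (metis carrier_matD(1))
  have colH: "col (hankel m a) j = Matrix.vec m (\<lambda>i. a (i + j + 1))" if "j < m" for j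
    using that by (intro eq_vecI) (auto simp: hankel_def)
  have "set (cols A) \<subseteq> set (cols (hankel m a))"
  proof
    fix c assume "c \<in> set (cols A)"
    then obtain j where j: "j < r" "c = col A j" using A by (auto simp: cols_def)
    then have "c = col (hankel m a) j"
      using rm by (subst colH) (auto simp: A_def)
    then show "c \<in> set (cols (hankel m a))"
      using j rm hankel_carrier[of m a] by (auto simp: cols_def)
  qed
  then have "span (set (cols A)) \<subseteq> span (set (cols (hankel m a)))"
    by (rule span_is_monotone)
  moreover have "set (cols (hankel m a)) \<subseteq> span (set (cols A))"
  proof
    fix c assume "c \<in> set (cols (hankel m a))"
    then obtain j where j: "j < m" "c = col (hankel m a) j"
      using hankel_carrier[of m a] by (auto simp: cols_def)
    have "\<exists>u \<in> carrier_vec r. c = A *\<^sub>v u"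
    proof (cases "j < r")
      case True
      then have "c = col A j" using j by (subst j(2), subst colH) (auto simp: A_def)
      then show ?thesis using A True by (intro bexI[of _ "unit_vec r j"]) (auto simp: unit)
    next
      case False
      obtain t where t: "t r = 1" "\<And>i. i < 2 * m - 1 - r \<Longrightarrow> (\<Sum>j\<le>r. a (i + j + 1) * t j) = 0"
        using rec unfolding recurrence_def by blast
      \<comment> \<open>All rows are exact here, since \<open>i\<close> and \<open>j\<close> are
        below \<open>m\<close> and so \<open>i + j < 2 * m - 1\<close>.\<close>
      obtain u where u: "\<And>i. i + (j - r) < 2 * m - 1 - r \<Longrightarrow> a (i + r + (j - r) + 1) = (\<Sum>j<r. a (i + j + 1) * u j)"
        using recurrence_extend[of t r "2 * m - 1 - r" a "j - r", OF t] by blast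
      have "c = A *\<^sub>v Matrix.vec r u"
      proof (rule eq_vecI)
        fix i assume "i < dim_vec (A *\<^sub>v Matrix.vec r u)"
        then have i: "i < m" using A by simp
        then have "c $ i = a (i + r + (j - r) + 1)"
          using j False by (simp add: colH)
        also have "\<dots> = (\<Sum>j<r. a (i + j + 1) * u j)" using i j False by (intro u) auto
        finally show "c $ i = (A *\<^sub>v Matrix.vec r u) $ i"
          using i by (simp add: A_def scalar_prod_def atLeast0LessThan)
      qed (use A j in \<open>simp add: hankel_def\<close>)
      then show ?thesis by (intro bexI[of _ "Matrix.vec r u"]) auto
    qed
    then obtain u where u: "u \<in> carrier_vec r" "c = A *\<^sub>v u" by blast
    then show "c \<in> span (set (cols A))"
      using lincomb_eq_mat_mult[OF A u(1) dist, symmetric] unfolding span_def by blast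
  qed
  then have "span (set (cols (hankel m a))) \<subseteq> span (set (cols A))"
    using colsA span_is_submodule by (intro span_is_subset) auto
  ultimately have "rank (hankel m a) = rank A"
    by (simp add: rank_def)
  also have "\<dots> = r"
    by (rule lin_indpt_full_rank[OF A dist indpt])
  finally show ?thesis .
qed

lemma mat_inverse_hankel:
  assumes pos: "hankel_pos r a"
  obtains B where "mat_inverse (hankel r a) = Some B"
proof (cases "mat_inverse (hankel r a)")
  case None
  have "det (hankel r a) \<noteq> 0"
  proof
    assume "det (hankel r a) = 0"
    then obtain v where v: "v \<in> carrier_vec r" "v \<noteq> 0\<^sub>v r" "hankel r a *\<^sub>v v = 0\<^sub>v r"
      using det_0_iff_vec_prod_zero_field[OF hankel_carrier] by blast
    then have "0 < v \<bullet> (hankel r a *\<^sub>v v)"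
      using pos hankel_carrier[of r a] by (auto simp: pos_definite_def simp flip: pos_definite_hankel)
    then show False using v by simp
  qed
  then show ?thesis
    using det_non_zero_imp_unit[OF hankel_carrier, of r a "()"] mat_inverse(1)[OF hankel_carrier None, of "()"]
    by simp
qed

text \<open>Column \<open>m\<close> is expressed by \<open>recurrence_extend\<close> with
  \<open>k = m - r\<close>. Its first \<open>r\<close> rows are exact and say that \<open>u\<close>
  is the inverse matrix applied to the vector in the condition; its row \<open>m - 1\<close> has the
  entry \<open>a (2 * m)\<close> and is the defect row. Hence the condition holds exactly when the
  defect is 0.\<close>

lemma star_condition_iff:
  assumes pos: "hankel_pos r a" and rm: "r < m"
    and t: "t r = 1" "\<And>i. i < 2 * m - 1 - r \<Longrightarrow> (\<Sum>j\<le>r. a (i + j + 1) * t j) = 0"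
  shows "star_condition m r a \<longleftrightarrow> (\<Sum>j\<le>r. a (2 * m - 1 - r + j + 1) * t j) = 0"
proof -
  define L where "L i = (\<Sum>j\<le>r. a (i + j + 1) * t j)" for i
  obtain B where B: "mat_inverse (hankel r a) = Some B"
    by (rule mat_inverse_hankel[OF pos])
  then have BH: "B * hankel r a = 1\<^sub>m r" "B \<in> carrier_mat r r"
    using mat_inverse(2)[OF hankel_carrier B] by auto
  obtain u where
    u: "\<And>i. i + (m - r) < 2 * m - 1 - r \<Longrightarrow> a (i + r + (m - r) + 1) = (\<Sum>j<r. a (i + j + 1) * u j)"
       "\<And>i. i + (m - r) = 2 * m - 1 - r \<Longrightarrow> a (i + r + (m - r) + 1) = (\<Sum>j<r. a (i + j + 1) * u j) + L (2 * m - 1 - r)"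
    using recurrence_extend[of t r "2 * m - 1 - r" a "m - r", OF t] unfolding L_def by blast
  have "Matrix.vec r (\<lambda>i. a (m + 1 + i)) = hankel r a *\<^sub>v Matrix.vec r u"
  proof (rule eq_vecI)
    fix i assume "i < dim_vec (hankel r a *\<^sub>v Matrix.vec r u)"
    then have i: "i < r" by (simp add: hankel_def)
    have "a (i + r + (m - r) + 1) = (\<Sum>j<r. a (i + j + 1) * u j)"
      using i rm by (intro u(1)) auto
    then show "Matrix.vec r (\<lambda>i. a (m + 1 + i)) $ i = (hankel r a *\<^sub>v Matrix.vec r u) $ i"
      using i rm by (subst hankel_mult_vec_index) (auto simp: add_ac)
  qed (simp add: hankel_def)
  then have "B *\<^sub>v Matrix.vec r (\<lambda>i. a (m + 1 + i)) = (B * hankel r a) *\<^sub>v Matrix.vec r u"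
    using BH(2) hankel_carrier[of r a] by (simp add: assoc_mult_mat_vec[of _ r r _ r])
  then have "B *\<^sub>v Matrix.vec r (\<lambda>i. a (m + 1 + i)) = Matrix.vec r u"
    using BH(1) by simp
  then have "star_condition m r a \<longleftrightarrow> a (2 * m) = (\<Sum>i<r. a (m + i) * u i)"
    unfolding star_condition_def using B BH(2)
    by (simp add: scalar_prod_def atLeast0LessThan del: index_mult_mat_vec)
  also have "a (2 * m) = (\<Sum>i<r. a (m + i) * u i) + L (2 * m - 1 - r)"
    using u(2)[of "m - 1"] rm by (simp add: mult_2)
  finally show ?thesis by (simp add: L_def)
qed

text \<open>There is one row more than in \<open>hankel_SE_min_iff\<close>, so the recurrence
  extends to \<open>a (2 * m)\<close>.\<close>

definition hankel_degenerate :: "nat \<Rightarrow> (nat \<Rightarrow> real) \<Rightarrow> bool" where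
  "hankel_degenerate m a \<longleftrightarrow> (\<exists>r<m. hankel_pos r a \<and> recurrence a (2 * m - r) r)"

text \<open>The order \<open>r\<close> of the recurrence is the rank by \<open>rank_hankel\<close>,
  and the additional row is the condition on \<open>a (2 * m)\<close> by
  \<open>star_condition_iff\<close>.\<close>

lemma SE_minimally_positive_star_condition_iff:
  assumes "0 < m"
  shows "SE_minimally_positive m (hankel m a) \<and> star_condition m (vec_space.rank m (hankel m a)) a \<longleftrightarrow>
    hankel_degenerate m a"
proof
  assume *: "SE_minimally_positive m (hankel m a) \<and> star_condition m (vec_space.rank m (hankel m a)) a"
  then obtain r where r: "r < m" "hankel_pos r a" "recurrence a (2 * m - 1 - r) r"
    using SE_minimally_positive_hankel[OF assms] hankel_SE_min_iff by blast
  then obtain t where t: "t r = 1" "\<And>i. i < 2 * m - 1 - r \<Longrightarrow> (\<Sum>j\<le>r. a (i + j + 1) * t j) = 0"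
    unfolding recurrence_def by blast
  have "star_condition m r a"
    using * rank_hankel[OF r(2,1,3)] by simp
  then have "(\<Sum>j\<le>r. a (2 * m - 1 - r + j + 1) * t j) = 0"
    using star_condition_iff[OF r(2,1) t] by blast
  moreover have "i < 2 * m - 1 - r \<or> i = 2 * m - 1 - r" if "i < 2 * m - r" for i
    using that by auto
  ultimately have "(\<Sum>j\<le>r. a (i + j + 1) * t j) = 0" if "i < 2 * m - r" for i
    using t(2)[of i] that by blast
  then show "hankel_degenerate m a"
    using r t(1) unfolding hankel_degenerate_def recurrence_def by blast
next
  assume "hankel_degenerate m a"
  then obtain r t where r: "r < m" "hankel_pos r a" and
    t: "t r = 1" "\<And>i. i < 2 * m - r \<Longrightarrow> (\<Sum>j\<le>r. a (i + j + 1) * t j) = 0"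
    unfolding hankel_degenerate_def recurrence_def by blast
  have t': "(\<Sum>j\<le>r. a (i + j + 1) * t j) = 0" if "i < 2 * m - 1 - r" for i
    using t(2) that by simp
  then have rec: "recurrence a (2 * m - 1 - r) r"
    using t(1) unfolding recurrence_def by blast
  have "(\<Sum>j\<le>r. a (2 * m - 1 - r + j + 1) * t j) = 0"
    using r(1) by (intro t(2)) simp
  then have "star_condition m r a"
    using star_condition_iff[OF r(2,1) t(1) t'] by blast
  then show "SE_minimally_positive m (hankel m a) \<and> star_condition m (vec_space.rank m (hankel m a)) a"
    using rank_hankel[OF r(2,1) rec] SE_minimally_positive_hankel[OF assms] hankel_SE_min_iff r rec by auto
qed

text \<open>This recursion runs parallel to Julia reduction of functions and drives the inductions
  on \<open>m\<close>. If \<open>a 1\<close> is not positive, \<open>hankel_pos r a\<close> leaves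
  only \<open>r = 0\<close>.\<close>

lemma hankel_degenerate_Suc:
  "hankel_degenerate (Suc m) a \<longleftrightarrow>
     (if 0 < a 1 then hankel_degenerate m (reduced_coeffs a) else \<forall>i<2 * Suc m. a (Suc i) = 0)"
proof (cases "0 < a 1")
  case True
  have "hankel_degenerate (Suc m) a \<longleftrightarrow> (\<exists>r<m. hankel_pos (Suc r) a \<and> recurrence a (2 * Suc m - Suc r) (Suc r))"
    unfolding hankel_degenerate_def
  proof (intro iffI; elim exE conjE)
    fix r assume r: "r < Suc m" "hankel_pos r a" "recurrence a (2 * Suc m - r) r"
    moreover have "r \<noteq> 0"
    proof
      assume "r = 0"
      then have "a (Suc 0) = 0" using r(3) by (simp add: recurrence_0)
      then show False using True by simp
    qed
    ultimately show "\<exists>r<m. hankel_pos (Suc r) a \<and> recurrence a (2 * Suc m - Suc r) (Suc r)"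
      by (metis Suc_less_SucD not0_implies_Suc)
  qed blast
  also have "\<dots> \<longleftrightarrow> hankel_degenerate m (reduced_coeffs a)"
    unfolding hankel_degenerate_def
  proof (intro ex_cong1 conj_cong refl)
    fix r assume "r < m"
    then have "2 * Suc m - Suc r = Suc (2 * m - r)" by simp
    then show "recurrence a (2 * Suc m - Suc r) (Suc r) \<longleftrightarrow> recurrence (reduced_coeffs a) (2 * m - r) r"
      using True recurrence_reduction by simp
  qed (use True hankel_pos_Suc in simp)
  finally show ?thesis using True by simp
next
  case False
  have "hankel_degenerate (Suc m) a \<longleftrightarrow> recurrence a (2 * Suc m - 0) 0"
    unfolding hankel_degenerate_def
  proof
    assume "\<exists>r<Suc m. hankel_pos r a \<and> recurrence a (2 * Suc m - r) r"
    then obtain r where "hankel_pos r a" "recurrence a (2 * Suc m - r) r" by blast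
    moreover from this have "r = 0" using False hankel_pos_Suc by (cases r) auto
    ultimately show "recurrence a (2 * Suc m - 0) 0" by simp
  qed (use hankel_pos_0 in blast)
  then show ?thesis using False by (simp add: recurrence_0)
qed

section \<open>Julia's inequality and Julia reduction\<close>

lemma upper_half_plane_iff: "z \<in> upper_half_plane \<longleftrightarrow> 0 < Im z"
  by (simp add: upper_half_plane_def)

lemma open_upper_half_plane: "open upper_half_plane"
  by (simp add: upper_half_plane_def open_halfspace_Im_gt)

lemma cmod_diff_cnj_sq: "(cmod (z - cnj w))\<^sup>2 = (cmod (z - w))\<^sup>2 + 4 * (Im z * Im w)"
  by (simp add: cmod_power2) (simp add: power2_eq_square algebra_simps)

text \<open>Cayley transforms at \<open>w\<close> and at \<open>f w\<close> turn \<open>f\<close>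
  into a self-map \<open>F\<close> of the unit disc fixing 0, to which the Schwarz lemma
  applies.\<close>

lemma Schwarz_Pick_half_plane_strict:
  assumes holo: "f holomorphic_on upper_half_plane" and pos: "\<And>z. 0 < Im z \<Longrightarrow> 0 < Im (f z)"
    and z: "0 < Im z" and w: "0 < Im w"
  shows "(cmod (f z - f w))\<^sup>2 * (Im z * Im w) \<le> (cmod (z - w))\<^sup>2 * (Im (f z) * Im (f w))"
proof -
  \<comment> \<open>The inverse of the Cayley transform \<open>(z - w) / (z - cnj w)\<close>; it
    takes 0 to \<open>w\<close>.\<close>
  define \<phi> where "\<phi> \<xi> = (w - cnj w * \<xi>) / (1 - \<xi>)" for \<xi>
  define F where "F \<xi> = (f (\<phi> \<xi>) - f w) / (f (\<phi> \<xi>) - cnj (f w))" for \<xi>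
  have Im_\<phi>: "0 < Im (\<phi> \<xi>)" if "cmod \<xi> < 1" for \<xi>
  proof -
    have ne: "1 - \<xi> \<noteq> 0" using that by auto
    have "Im (\<phi> \<xi>) = Im w * (1 - (cmod \<xi>)\<^sup>2) / (cmod (1 - \<xi>))\<^sup>2"
      unfolding \<phi>_def Im_divide cmod_power2 by (simp add: power2_eq_square algebra_simps)
    moreover have "(cmod \<xi>)\<^sup>2 < 1" using that by (simp add: power_less_one_iff abs_square_less_1)
    ultimately show ?thesis using w ne by simp
  qed
  have denom: "f \<zeta> - cnj (f w) \<noteq> 0" if "0 < Im \<zeta>" for \<zeta>
  proof
    assume "f \<zeta> - cnj (f w) = 0"
    then have "Im (f \<zeta>) = - Im (f w)" by (metis Im_divide cnj.simps(2) eq_iff_diff_eq_0)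
    then show False using pos[OF that] pos[OF w] by simp
  qed
  have "\<phi> holomorphic_on ball 0 1"
    unfolding \<phi>_def by (intro holomorphic_intros) auto
  moreover have "\<phi> ` ball 0 1 \<subseteq> upper_half_plane"
    using Im_\<phi> by (auto simp: upper_half_plane_iff)
  ultimately have "(f \<circ> \<phi>) holomorphic_on ball 0 1"
    using holo by (meson holomorphic_on_compose_gen)
  then have "F holomorphic_on ball 0 1"
    unfolding F_def comp_def by (intro holomorphic_intros) (use Im_\<phi> denom in auto)
  moreover have "F 0 = 0" by (simp add: F_def \<phi>_def)
  moreover have "cmod (F \<xi>) < 1" if "cmod \<xi> < 1" for \<xi>
  proof -
    have "(cmod (f (\<phi> \<xi>) - f w))\<^sup>2 < (cmod (f (\<phi> \<xi>) - cnj (f w)))\<^sup>2"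
      unfolding cmod_diff_cnj_sq using pos[OF Im_\<phi>[OF that]] pos[OF w] by simp
    then have "cmod (f (\<phi> \<xi>) - f w) < cmod (f (\<phi> \<xi>) - cnj (f w))"
      by (rule power2_less_imp_less) simp
    then show ?thesis
      using denom[OF Im_\<phi>[OF that]] by (simp add: F_def norm_divide)
  qed
  moreover define \<xi> where "\<xi> = (z - w) / (z - cnj w)"
  have zw: "z - cnj w \<noteq> 0"
    using z w by (auto simp: complex_eq_iff)
  have ww: "w - cnj w \<noteq> 0"
    using w by (auto simp: complex_eq_iff)
  have \<xi>: "cmod \<xi> < 1"
  proof -
    have "(cmod (z - w))\<^sup>2 < (cmod (z - cnj w))\<^sup>2"
      unfolding cmod_diff_cnj_sq using z w by simp
    then have "cmod (z - w) < cmod (z - cnj w)"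
      by (rule power2_less_imp_less) simp
    then show ?thesis using zw by (simp add: \<xi>_def norm_divide)
  qed
  ultimately have le: "cmod (F \<xi>) \<le> cmod \<xi>"
    using Schwarz_Lemma(1)[of F \<xi>] by blast
  have "1 - \<xi> = (w - cnj w) / (z - cnj w)" "w - cnj w * \<xi> = z * (w - cnj w) / (z - cnj w)"
    using zw by (auto simp: \<xi>_def field_simps)
  then have "\<phi> \<xi> = z"
    using zw ww by (simp add: \<phi>_def)
  then have "cmod (f z - f w) / cmod (f z - cnj (f w)) \<le> cmod (z - w) / cmod (z - cnj w)"
    using le by (simp add: F_def \<xi>_def norm_divide)
  then have "cmod (f z - f w) * cmod (z - cnj w) \<le> cmod (z - w) * cmod (f z - cnj (f w))"
    using zw denom[OF z] by (simp add: field_simps)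
  then have "(cmod (f z - f w) * cmod (z - cnj w))\<^sup>2 \<le> (cmod (z - w) * cmod (f z - cnj (f w)))\<^sup>2"
    by (intro power_mono) auto
  \<comment> \<open>Expanding the squared distances to the conjugate points leaves the common term
    \<open>|f z - f w|\<^sup>2 |z - w|\<^sup>2\<close> on both sides, which cancels.\<close>
  then show ?thesis
    unfolding power_mult_distrib cmod_diff_cnj_sq by (simp add: algebra_simps)
qed

lemma Schwarz_Pick_half_plane:
  assumes f: "f \<in> pick_class" and z: "0 < Im z" and w: "0 < Im w"
  shows "(cmod (f z - f w))\<^sup>2 * (Im z * Im w) \<le> (cmod (z - w))\<^sup>2 * (Im (f z) * Im (f w))"
proof -
  \<comment> \<open>Adding \<open>\<i>\<delta>\<close> to \<open>f\<close> makes its imaginary part strictly positive.\<close>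
  have ineq: "(cmod (f z - f w))\<^sup>2 * (Im z * Im w) \<le> (cmod (z - w))\<^sup>2 * ((Im (f z) + \<delta>) * (Im (f w) + \<delta>))"
    if "0 < \<delta>" for \<delta>
  proof -
    have "(\<lambda>z. f z + \<i> * of_real \<delta>) holomorphic_on upper_half_plane"
      using f by (auto simp: pick_class_def intro!: holomorphic_intros)
    moreover have "0 < Im (f z + \<i> * of_real \<delta>)" if "0 < Im z" for z
      using f that \<open>0 < \<delta>\<close> by (auto simp: pick_class_def upper_half_plane_iff intro: add_nonneg_pos)
    ultimately show ?thesis
      using Schwarz_Pick_half_plane_strict[of "\<lambda>z. f z + \<i> * of_real \<delta>" z w] z w by simp
  qed
  have "((\<lambda>\<delta>. (cmod (z - w))\<^sup>2 * ((Im (f z) + \<delta>) * (Im (f w) + \<delta>))) \<longlongrightarrow>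
      (cmod (z - w))\<^sup>2 * ((Im (f z) + 0) * (Im (f w) + 0))) (at_right 0)"
    by (intro tendsto_intros)
  then show ?thesis
    using ineq by (intro tendsto_lowerbound[where F = "at_right (0::real)"]) (auto simp: eventually_at_filter)
qed

section \<open>Expansions along the vertical line through \<open>x\<close>\<close>

definition radial_filter :: "real \<Rightarrow> complex filter" where
  "radial_filter x = filtermap (\<lambda>y. Complex x y) (at_right 0)"

lemma radial_filter_nontrivial [simp]: "radial_filter x \<noteq> bot"
  by (simp add: radial_filter_def filtermap_bot_iff)

lemma tendsto_radial_filter_iff:
  "(h \<longlongrightarrow> l) (radial_filter x) \<longleftrightarrow> ((\<lambda>y. h (Complex x y)) \<longlongrightarrow> l) (at_right 0)"
  by (simp add: radial_filter_def filterlim_filtermap)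

lemma eventually_radial_filter:
  "eventually (\<lambda>z. Re z = x \<and> 0 < Im z) (radial_filter x)"
  by (auto simp: radial_filter_def eventually_filtermap eventually_at_filter)

lemma tendsto_radial_filter_ident: "((\<lambda>z. z - of_real x) \<longlongrightarrow> 0) (radial_filter x)"
proof -
  have "((\<lambda>y. \<i> * complex_of_real y) \<longlongrightarrow> \<i> * of_real 0) (at_right 0)"
    by (intro tendsto_intros)
  then show ?thesis
    by (simp add: tendsto_radial_filter_iff Complex_eq)
qed

definition radial_expansion :: "real \<Rightarrow> nat \<Rightarrow> (nat \<Rightarrow> real) \<Rightarrow> (complex \<Rightarrow> complex) \<Rightarrow> bool" where
  "radial_expansion x n a f \<longleftrightarrow>
     ((\<lambda>z. (f z - (\<Sum>k\<le>n. complex_of_real (a k) * (z - complex_of_real x) ^ k)) / (z - complex_of_real x) ^ n)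
       \<longlongrightarrow> 0) (radial_filter x)"

lemma radial_expansion_mono:
  assumes "radial_expansion x n a f" "k \<le> n"
  shows "radial_expansion x k a f"
  using assms(2,1)
proof (induction k rule: inc_induct)
  case (step k)
  let ?r = "\<lambda>n z. (f z - (\<Sum>k\<le>n. complex_of_real (a k) * (z - complex_of_real x) ^ k)) / (z - complex_of_real x) ^ n"
  have "(?r (Suc k) \<longlongrightarrow> 0) (radial_filter x)"
    using step by (simp add: radial_expansion_def)
  \<comment> \<open>The remainder quotient of order \<open>k\<close> is \<open>z - x\<close> times
    that of order \<open>k + 1\<close>, plus the linear term of the omitted coefficient.\<close>
  then have "((\<lambda>z. (z - of_real x) * ?r (Suc k) z + of_real (a (Suc k)) * (z - of_real x)) \<longlongrightarrow> 0 * 0 + of_real (a (Suc k)) * 0) (radial_filter x)"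
    by (intro tendsto_intros tendsto_radial_filter_ident)
  moreover have "eventually (\<lambda>z. (z - of_real x) * ?r (Suc k) z + of_real (a (Suc k)) * (z - of_real x) = ?r k z) (radial_filter x)"
    using eventually_radial_filter
  proof eventually_elim
    case (elim z)
    then have "z - of_real x \<noteq> 0" by (auto simp: complex_eq_iff)
    then show ?case by (simp add: field_simps)
  qed
  ultimately show ?case
    unfolding radial_expansion_def by (simp add: tendsto_cong)
qed

lemma radial_expansion_quotient:
  assumes "radial_expansion x n a f" "0 < n"
  shows "((\<lambda>z. (f z - of_real (a 0)) / (z - of_real x)) \<longlongrightarrow> of_real (a 1)) (radial_filter x)"
proof -
  have "radial_expansion x 1 a f"
    using assms by (intro radial_expansion_mono[OF assms(1)]) simp
  then have "((\<lambda>z. (f z - (of_real (a 0) + of_real (a 1) * (z - of_real x))) / (z - of_real x) + of_real (a 1)) \<longlongrightarrow> 0 + of_real (a 1)) (radial_filter x)"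
    unfolding radial_expansion_def by (intro tendsto_intros) simp
  moreover have "eventually (\<lambda>z. (f z - (of_real (a 0) + of_real (a 1) * (z - of_real x))) / (z - of_real x) + of_real (a 1)
      = (f z - of_real (a 0)) / (z - of_real x)) (radial_filter x)"
    using eventually_radial_filter
  proof eventually_elim
    case (elim z)
    then have "z - of_real x \<noteq> 0" by (auto simp: complex_eq_iff)
    then show ?case by (simp add: field_simps)
  qed
  ultimately show ?thesis by (simp add: tendsto_cong)
qed

text \<open>Schwarz-Pick for \<open>z\<close> and \<open>w\<close> is divided by
  \<open>Im w\<close>, and \<open>w\<close> descends to \<open>x\<close>. Because \<open>a 0\<close>
  is real and \<open>w - x\<close> is purely imaginary, \<open>Im (f w) / Im w\<close> is the real
  part of the difference quotient and tends to \<open>a 1\<close>.\<close>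

lemma Julia_inequality:
  assumes f: "f \<in> pick_class" and exp: "radial_expansion x n a f" and n: "0 < n"
  shows "0 \<le> a 1"
    and "0 < Im z \<Longrightarrow> (cmod (f z - of_real (a 0)))\<^sup>2 * Im z \<le> (cmod (z - of_real x))\<^sup>2 * (Im (f z) * a 1)"
proof -
  have "((\<lambda>z. Re ((f z - of_real (a 0)) / (z - of_real x))) \<longlongrightarrow> Re (of_real (a 1))) (radial_filter x)"
    by (intro tendsto_intros radial_expansion_quotient[OF exp n])
  moreover have "eventually (\<lambda>z. Re ((f z - of_real (a 0)) / (z - of_real x)) = Im (f z) / Im z) (radial_filter x)"
    using eventually_radial_filter
  proof eventually_elim
    case (elim z)
    then have "z - of_real x = \<i> * of_real (Im z)" by (auto simp: complex_eq_iff)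
    then show ?case using elim by (simp add: Re_divide power2_eq_square)
  qed
  ultimately have quot: "((\<lambda>z. Im (f z) / Im z) \<longlongrightarrow> a 1) (radial_filter x)"
    by (simp add: tendsto_cong)
  moreover have ev: "eventually (\<lambda>z. 0 \<le> Im (f z) / Im z) (radial_filter x)"
    using eventually_radial_filter by eventually_elim (use f in \<open>auto simp: pick_class_def upper_half_plane_iff\<close>)
  ultimately show "0 \<le> a 1"
    by (intro tendsto_lowerbound[of _ _ "radial_filter x"]) auto
  assume z: "0 < Im z"
  have "radial_expansion x 0 a f" by (rule radial_expansion_mono[OF exp]) simp
  then have "((\<lambda>w. f w - of_real (a 0) + of_real (a 0)) \<longlongrightarrow> 0 + of_real (a 0)) (radial_filter x)"
    unfolding radial_expansion_def by (intro tendsto_intros) simp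
  then have lim_f: "(f \<longlongrightarrow> of_real (a 0)) (radial_filter x)" by simp
  have "((\<lambda>w. w - of_real x + of_real x) \<longlongrightarrow> 0 + complex_of_real x) (radial_filter x)"
    by (intro tendsto_intros tendsto_radial_filter_ident)
  then have lim_w: "((\<lambda>w. w) \<longlongrightarrow> complex_of_real x) (radial_filter x)" by simp
  have lhs: "((\<lambda>w. (cmod (f z - f w))\<^sup>2 * Im z) \<longlongrightarrow> (cmod (f z - of_real (a 0)))\<^sup>2 * Im z) (radial_filter x)"
    by (intro tendsto_intros lim_f)
  have rhs: "((\<lambda>w. (cmod (z - w))\<^sup>2 * (Im (f z) * (Im (f w) / Im w))) \<longlongrightarrow> (cmod (z - of_real x))\<^sup>2 * (Im (f z) * a 1)) (radial_filter x)"
    by (intro tendsto_intros lim_w quot)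
  have "eventually (\<lambda>w. (cmod (f z - f w))\<^sup>2 * Im z \<le> (cmod (z - w))\<^sup>2 * (Im (f z) * (Im (f w) / Im w))) (radial_filter x)"
    using eventually_radial_filter
  proof eventually_elim
    case (elim w)
    then show ?case
      using Schwarz_Pick_half_plane[OF f z, of w] by (simp add: field_simps)
  qed
  then show "(cmod (f z - of_real (a 0)))\<^sup>2 * Im z \<le> (cmod (z - of_real x))\<^sup>2 * (Im (f z) * a 1)"
    by (rule tendsto_le[OF radial_filter_nontrivial rhs lhs])
qed

text \<open>With \<open>a 1 = 0\<close> the right-hand side of Julia's inequality vanishes. The
  coefficients are then compared one by one: once the earlier ones are 0, the remainder quotient of
  order \<open>k\<close> is the constant \<open>- a k\<close>.\<close>

lemma pick_zero_derivative_imp_constant: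
  assumes f: "f \<in> pick_class" and exp: "radial_expansion x n a f" and n: "0 < n" and a1: "a 1 = 0"
  shows "0 < Im z \<Longrightarrow> f z = of_real (a 0)" and "0 < k \<Longrightarrow> k \<le> n \<Longrightarrow> a k = 0"
proof -
  have const: "f z = of_real (a 0)" if "0 < Im z" for z
    using Julia_inequality(2)[OF f exp n that] a1 that by (simp add: mult_le_0_iff)
  then show "0 < Im z \<Longrightarrow> f z = of_real (a 0)" .
  show "a k = 0" if "0 < k" "k \<le> n"
    using that
  proof (induction k rule: less_induct)
    case (less k)
    have "radial_expansion x k a f" using less.prems by (intro radial_expansion_mono[OF exp])
    moreover have "eventually (\<lambda>z. (f z - (\<Sum>j\<le>k. of_real (a j) * (z - of_real x) ^ j)) / (z - of_real x) ^ k
        = - of_real (a k)) (radial_filter x)"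
      using eventually_radial_filter
    proof eventually_elim
      case (elim z)
      then have ne: "z - of_real x \<noteq> 0" by (auto simp: complex_eq_iff)
      have "(\<Sum>j\<le>k. complex_of_real (a j) * (z - of_real x) ^ j) =
          (\<Sum>j\<in>{0, k}. complex_of_real (a j) * (z - of_real x) ^ j)"
        using less by (intro sum.mono_neutral_right) auto
      then show ?case using ne less.prems elim const[of z] by simp
    qed
    ultimately have "((\<lambda>_. - complex_of_real (a k)) \<longlongrightarrow> 0) (radial_filter x)"
      unfolding radial_expansion_def by (simp add: tendsto_cong)
    then show ?case by (simp add: tendsto_const_iff)
  qed
qed

text \<open>The product of the two truncations agrees with 1 up to degree \<open>N\<close>, so the
  difference is divisible by the power \<open>N + 1\<close> of the variable.\<close>

lemma truncated_inverse_tendsto: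
  fixes p q :: "nat \<Rightarrow> complex"
  assumes "\<And>n. (\<Sum>i\<le>n. q i * p (n - i)) = (if n = 0 then 1 else 0)"
  shows "((\<lambda>\<zeta>. ((\<Sum>k\<le>N. q k * \<zeta> ^ k) * (\<Sum>k\<le>N. p k * \<zeta> ^ k) - 1) / \<zeta> ^ N) \<longlongrightarrow> 0) (at 0)"
proof -
  define P where "P = (\<Sum>k\<le>N. Polynomial.monom (p k) k)"
  define Q where "Q = (\<Sum>k\<le>N. Polynomial.monom (q k) k)"
  have poly: "poly P \<zeta> = (\<Sum>k\<le>N. p k * \<zeta> ^ k)" "poly Q \<zeta> = (\<Sum>k\<le>N. q k * \<zeta> ^ k)" for \<zeta>
    by (simp_all add: P_def Q_def poly_sum poly_monom)
  have coeff: "coeff P k = p k" "coeff Q k = q k" if "k \<le> N" for k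
    using that by (simp_all add: P_def Q_def coeff_sum)
  have "coeff (Q * P - 1) k = 0" if "k \<le> N" for k
  proof -
    have "coeff (Q * P) k = (\<Sum>i\<le>k. q i * p (k - i))"
      using that coeff by (simp add: coeff_mult)
    then show ?thesis using assms[of k] by (simp add: one_pCons coeff_pCons split: nat.splits)
  qed
  then have "Polynomial.monom 1 (Suc N) dvd Q * P - 1"
    by (simp add: monom_1_dvd_iff' less_Suc_eq_le)
  then obtain S where S: "Q * P - 1 = Polynomial.monom 1 (Suc N) * S" by (auto simp: dvd_def)
  have eq: "poly Q \<zeta> * poly P \<zeta> - 1 = \<zeta> ^ Suc N * poly S \<zeta>" for \<zeta>
    using arg_cong[OF S, of "\<lambda>p. poly p \<zeta>"] by (simp add: poly_monom)
  have "((\<lambda>\<zeta>. \<zeta> * poly S \<zeta>) \<longlongrightarrow> 0 * poly S 0) (at 0)"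
    by (intro tendsto_intros)
  moreover have "eventually (\<lambda>\<zeta>. \<zeta> * poly S \<zeta> = (poly Q \<zeta> * poly P \<zeta> - 1) / \<zeta> ^ N) (at 0)"
    by (auto simp: eventually_at_filter eq)
  ultimately show ?thesis
    by (simp add: tendsto_cong poly)
qed

text \<open>Julia's inequality, divided by both squared distances, says that \<open>g\<close> has
  nonnegative imaginary part. Two orders of the expansion are used up: one in passing to
  \<open>\<phi> = (f - a 0) / (z - x)\<close>, one in dividing \<open>1 / a 1 - 1 / \<phi>\<close>
  by \<open>z - x\<close>.\<close>

lemma Julia_reduction:
  assumes f: "f \<in> pick_class" and exp: "radial_expansion x (n + 2) a f" and a1: "0 < a 1"
  defines "g \<equiv> \<lambda>z. 1 / (of_real (a 1) * (z - of_real x)) - 1 / (f z - of_real (a 0))"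
  shows "g \<in> pick_class" and "radial_expansion x n (reduced_coeffs a) g"
    and "0 < Im z \<Longrightarrow> f z = of_real (a 0) + (z - of_real x) * inverse (1 / of_real (a 1) - (z - of_real x) * g z)"
proof -
  have zx: "z \<noteq> of_real x" if "0 < Im z" for z using that by auto
  \<comment> \<open>If the real value \<open>a 0\<close> were attained, Schwarz-Pick would make
    \<open>f\<close> constant, against \<open>a 1 > 0\<close>.\<close>
  have ne: "f z \<noteq> of_real (a 0)" if z: "0 < Im z" for z
  proof
    assume fz: "f z = of_real (a 0)"
    have "f w = of_real (a 0)" if w: "0 < Im w" for w
      using Schwarz_Pick_half_plane[OF f z w] z w fz by (simp add: mult_le_0_iff zero_less_mult_iff)
    then have "eventually (\<lambda>z. (f z - of_real (a 0)) / (z - of_real x) = 0) (radial_filter x)"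
      by (intro eventually_mono[OF eventually_radial_filter]) auto
    then have "((\<lambda>_. 0) \<longlongrightarrow> complex_of_real (a 1)) (radial_filter x)"
      by (rule Lim_transform_eventually[rotated]) (rule radial_expansion_quotient[OF exp], simp)
    then show False using a1 by (simp add: tendsto_const_iff)
  qed
  show "g \<in> pick_class"
    unfolding pick_class_def
  proof (intro CollectI conjI ballI)
    show "g holomorphic_on upper_half_plane"
      unfolding g_def using f a1 ne zx
      by (intro holomorphic_intros) (auto simp: pick_class_def upper_half_plane_iff)
    fix z assume "z \<in> upper_half_plane"
    then have z: "0 < Im z" by (simp add: upper_half_plane_iff)
    have "(cmod (f z - of_real (a 0)))\<^sup>2 * Im z \<le> (cmod (z - of_real x))\<^sup>2 * (Im (f z) * a 1)"
      by (rule Julia_inequality(2)[OF f exp _ z]) simp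
    moreover have "0 < (cmod (f z - of_real (a 0)))\<^sup>2" "0 < (cmod (z - of_real x))\<^sup>2"
      using ne[OF z] zx[OF z] by simp_all
    ultimately have "Im z / (a 1 * (cmod (z - of_real x))\<^sup>2) \<le> Im (f z) / (cmod (f z - of_real (a 0)))\<^sup>2"
      using a1 by (simp add: field_simps)
    moreover have "Im (1 / u) = - Im u / (cmod u)\<^sup>2" for u
      by (simp add: Im_divide cmod_power2)
    moreover have "1 / (of_real (a 1) * (z - of_real x)) = of_real (1 / a 1) * (1 / (z - of_real x))"
      by simp
    ultimately show "0 \<le> Im (g z)"
      unfolding g_def by (simp only: minus_complex.simps Im_complex_of_real Re_complex_of_real times_complex.simps) simp
  qed
  show "f z = of_real (a 0) + (z - of_real x) * inverse (1 / of_real (a 1) - (z - of_real x) * g z)" if "0 < Im z"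
  proof -
    have "(z - of_real x) * g z = 1 / of_real (a 1) - (z - of_real x) / (f z - of_real (a 0))"
    proof -
      have "\<zeta> * (1 / (c * \<zeta>) - 1 / d) = 1 / c - \<zeta> / d" if "\<zeta> \<noteq> 0" for \<zeta> c d :: complex
        using that by (simp add: right_diff_distrib)
      then show ?thesis unfolding g_def using zx[OF that] by simp
    qed
    then show ?thesis using zx[OF that] ne[OF that] by simp
  qed
  define N where "N = n + 1"
  define p where "p k = complex_of_real (a (Suc k))" for k
  define q where "q k = complex_of_real (fps_nth (inverse (Abs_fps (\<lambda>k. a (Suc k)))) k)" for k
  define P where "P \<zeta> = (\<Sum>k\<le>N. p k * \<zeta> ^ k)" for \<zeta>
  define Q where "Q \<zeta> = (\<Sum>k\<le>N. q k * \<zeta> ^ k)" for \<zeta>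
  define \<phi> where "\<phi> z = (f z - of_real (a 0)) / (z - of_real x)" for z
  let ?\<zeta> = "\<lambda>z. z - complex_of_real x"
  have conv: "(\<Sum>i\<le>n. q i * p (n - i)) = (if n = 0 then 1 else 0)" for n
    using inverse_fps_convolution[of "\<lambda>k. a (Suc k)", OF _ refl, of n] a1
    by (simp add: q_def p_def flip: of_real_mult of_real_sum)
  have lim_\<zeta>: "filterlim ?\<zeta> (at 0) (radial_filter x)"
    unfolding filterlim_at
    by (intro conjI tendsto_radial_filter_ident eventually_mono[OF eventually_radial_filter])
      (auto simp: complex_eq_iff)
  have "((\<lambda>z. (Q (?\<zeta> z) * P (?\<zeta> z) - 1) / ?\<zeta> z ^ N) \<longlongrightarrow> 0) (radial_filter x)"
    using filterlim_compose[OF truncated_inverse_tendsto[OF conv, of N] lim_\<zeta>] by (simp add: P_def Q_def)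
  moreover have "((\<lambda>z. (\<phi> z - P (?\<zeta> z)) / ?\<zeta> z ^ N) \<longlongrightarrow> 0) (radial_filter x)"
  proof -
    have "eventually (\<lambda>z. (f z - (\<Sum>k\<le>n+2. of_real (a k) * ?\<zeta> z ^ k)) / ?\<zeta> z ^ (n + 2) =
        (\<phi> z - P (?\<zeta> z)) / ?\<zeta> z ^ N) (radial_filter x)"
      using eventually_radial_filter
    proof eventually_elim
      case (elim z)
      then have ne0: "?\<zeta> z \<noteq> 0" by (auto simp: complex_eq_iff)
      have "(\<Sum>k\<le>n+2. of_real (a k) * ?\<zeta> z ^ k) = of_real (a 0) + (\<Sum>k\<le>N. of_real (a (Suc k)) * ?\<zeta> z ^ Suc k)"
        unfolding N_def using sum.atMost_Suc_shift[of "\<lambda>k. of_real (a k) * ?\<zeta> z ^ k" "n + 1"] by simp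
      also have "(\<Sum>k\<le>N. of_real (a (Suc k)) * ?\<zeta> z ^ Suc k) = ?\<zeta> z * P (?\<zeta> z)"
        by (simp add: P_def p_def sum_distrib_left mult_ac)
      finally have "(\<Sum>k\<le>n+2. of_real (a k) * ?\<zeta> z ^ k) = of_real (a 0) + ?\<zeta> z * P (?\<zeta> z)" .
      moreover have "?\<zeta> z * \<phi> z = f z - of_real (a 0)"
        using ne0 by (simp add: \<phi>_def)
      ultimately have "f z - (\<Sum>k\<le>n+2. of_real (a k) * ?\<zeta> z ^ k) = ?\<zeta> z * (\<phi> z - P (?\<zeta> z))"
        by (simp only: right_diff_distrib diff_diff_eq)
      moreover have "?\<zeta> z ^ (n + 2) = ?\<zeta> z * ?\<zeta> z ^ N" by (simp add: N_def)
      ultimately show ?case using ne0 by simp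
    qed
    then show ?thesis
      using exp unfolding radial_expansion_def by (simp add: tendsto_cong)
  qed
  moreover have "((\<lambda>z. Q (?\<zeta> z)) \<longlongrightarrow> Q 0) (radial_filter x)"
    unfolding Q_def by (intro tendsto_intros tendsto_radial_filter_ident)
  moreover have lim_\<phi>: "(\<phi> \<longlongrightarrow> of_real (a 1)) (radial_filter x)"
    unfolding \<phi>_def using radial_expansion_quotient[OF exp] by simp
  \<comment> \<open>The identity \<open>Q - 1/\<phi> = ((Q P - 1) + Q (\<phi> - P)) / \<phi>\<close>
    splits the error into that of the truncated inverse and that of the expansion of
    \<open>\<phi>\<close>, both of order \<open>o((z - x)^N)\<close>.\<close>
  ultimately have "((\<lambda>z. ((Q (?\<zeta> z) * P (?\<zeta> z) - 1) / ?\<zeta> z ^ N + Q (?\<zeta> z) * ((\<phi> z - P (?\<zeta> z)) / ?\<zeta> z ^ N)) / \<phi> z)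
      \<longlongrightarrow> (0 + Q 0 * 0) / of_real (a 1)) (radial_filter x)"
    using a1 by (intro tendsto_intros) auto
  moreover have "eventually (\<lambda>z. ((Q (?\<zeta> z) * P (?\<zeta> z) - 1) / ?\<zeta> z ^ N + Q (?\<zeta> z) * ((\<phi> z - P (?\<zeta> z)) / ?\<zeta> z ^ N)) / \<phi> z
      = (g z - (\<Sum>k\<le>n. of_real (reduced_coeffs a k) * ?\<zeta> z ^ k)) / ?\<zeta> z ^ n) (radial_filter x)"
    using eventually_radial_filter
  proof eventually_elim
    case (elim z)
    then have ne0: "?\<zeta> z \<noteq> 0" by (auto simp: complex_eq_iff)
    have \<phi>0: "\<phi> z \<noteq> 0" using ne[of z] ne0 elim by (simp add: \<phi>_def)
    have "Q (?\<zeta> z) = q 0 + (\<Sum>k\<le>n. q (Suc k) * ?\<zeta> z ^ Suc k)"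
      unfolding Q_def N_def using sum.atMost_Suc_shift[of "\<lambda>k. q k * ?\<zeta> z ^ k" n] by simp
    also have "(\<Sum>k\<le>n. q (Suc k) * ?\<zeta> z ^ Suc k) = - (?\<zeta> z * (\<Sum>k\<le>n. of_real (reduced_coeffs a k) * ?\<zeta> z ^ k))"
      by (simp add: q_def reduced_coeffs_def sum_distrib_left sum_negf mult_ac)
    finally have Q: "Q (?\<zeta> z) = 1 / of_real (a 1) - ?\<zeta> z * (\<Sum>k\<le>n. of_real (reduced_coeffs a k) * ?\<zeta> z ^ k)"
      by (simp add: q_def field_simps)
    have "g z = (1 / of_real (a 1) - 1 / \<phi> z) / ?\<zeta> z"
      using ne0 a1 ne[of z] elim by (simp add: g_def \<phi>_def field_simps)
    then have "?\<zeta> z * (g z - (\<Sum>k\<le>n. of_real (reduced_coeffs a k) * ?\<zeta> z ^ k)) = Q (?\<zeta> z) - 1 / \<phi> z"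
      unfolding Q right_diff_distrib using ne0 by simp
    then have "g z - (\<Sum>k\<le>n. of_real (reduced_coeffs a k) * ?\<zeta> z ^ k) = (Q (?\<zeta> z) - 1 / \<phi> z) / ?\<zeta> z"
      using ne0 by (simp add: eq_divide_eq mult.commute)
    then have "(g z - (\<Sum>k\<le>n. of_real (reduced_coeffs a k) * ?\<zeta> z ^ k)) / ?\<zeta> z ^ n = (Q (?\<zeta> z) - 1 / \<phi> z) / ?\<zeta> z ^ N"
      by (simp add: N_def)
    moreover have "Q (?\<zeta> z) - 1 / \<phi> z = ((Q (?\<zeta> z) * P (?\<zeta> z) - 1) + Q (?\<zeta> z) * (\<phi> z - P (?\<zeta> z))) / \<phi> z"
      using \<phi>0 by (simp add: field_simps)
    ultimately show ?case
      by (simp add: add_divide_distrib mult.commute[of "\<phi> z"])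
  qed
  ultimately show "radial_expansion x n (reduced_coeffs a) g"
    unfolding radial_expansion_def by (simp add: tendsto_cong)
qed

section \<open>Comparison of the solution concepts\<close>

text \<open>Formal power series make the prescribed derivatives into coefficients, so that the
  inverse of Julia reduction can be carried out algebraically at \<open>x\<close>.\<close>

lemma analytic_solution_iff_fps:
  "analytic_solution x n a f \<longleftrightarrow> f \<in> pick_class \<and>
     (\<exists>g F. (\<lambda>t. g (of_real x + t)) has_fps_expansion F \<and>
        eventually (\<lambda>z. z \<in> upper_half_plane \<longrightarrow> g z = f z) (nhds (of_real x)) \<and>
        (\<forall>k\<le>n. fps_nth F k = of_real (a k)))"
proof (intro iffI conjI)
  assume sol: "analytic_solution x n a f"
  then show "f \<in> pick_class" by (simp add: analytic_solution_def)
  from sol obtain U g where U: "open U" "complex_of_real x \<in> U" "g holomorphic_on U"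
      "\<And>z. z \<in> U \<inter> upper_half_plane \<Longrightarrow> g z = f z"
      "\<And>k. k \<le> n \<Longrightarrow> (deriv ^^ k) g (complex_of_real x) / fact k = complex_of_real (a k)"
    unfolding analytic_solution_def by blast
  then have "g analytic_on {of_real x}"
    by (auto simp: analytic_at)
  then have "(\<lambda>t. g (of_real x + t)) has_fps_expansion fps_expansion g (of_real x)"
    by (rule analytic_at_imp_has_fps_expansion)
  moreover have "eventually (\<lambda>z. z \<in> upper_half_plane \<longrightarrow> g z = f z) (nhds (of_real x))"
    using eventually_nhds_in_open[OF U(1,2)] by eventually_elim (use U(4) in auto)
  ultimately show "\<exists>g F. (\<lambda>t. g (of_real x + t)) has_fps_expansion F \<and>
        eventually (\<lambda>z. z \<in> upper_half_plane \<longrightarrow> g z = f z) (nhds (of_real x)) \<and>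
        (\<forall>k\<le>n. fps_nth F k = of_real (a k))"
    using U(5) by (intro exI[of _ g] exI[of _ "fps_expansion g (of_real x)"]) (simp add: fps_expansion_def)
next
  assume "f \<in> pick_class \<and>
     (\<exists>g F. (\<lambda>t. g (of_real x + t)) has_fps_expansion F \<and>
        eventually (\<lambda>z. z \<in> upper_half_plane \<longrightarrow> g z = f z) (nhds (of_real x)) \<and>
        (\<forall>k\<le>n. fps_nth F k = of_real (a k)))"
  then obtain g F where f: "f \<in> pick_class" and F: "(\<lambda>t. g (of_real x + t)) has_fps_expansion F"
    and ev: "eventually (\<lambda>z. z \<in> upper_half_plane \<longrightarrow> g z = f z) (nhds (of_real x))"
    and coeff: "\<And>k. k \<le> n \<Longrightarrow> fps_nth F k = of_real (a k)"
    by blast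
  obtain V where V: "open V" "complex_of_real x \<in> V" "\<And>z. z \<in> V \<Longrightarrow> z \<in> upper_half_plane \<Longrightarrow> g z = f z"
    using ev unfolding eventually_nhds by blast
  have "g analytic_on {of_real x}"
    by (rule has_fps_expansion_imp_analytic[OF F])
  then obtain W where W: "open W" "complex_of_real x \<in> W" "g holomorphic_on W"
    by (auto simp: analytic_at)
  have "(deriv ^^ k) g (of_real x) / fact k = of_real (a k)" if "k \<le> n" for k
    using fps_nth_fps_expansion[OF F, of k] coeff[OF that]
    by (simp add: higher_deriv_shift_0[of k g "of_real x"] o_def)
  then show "analytic_solution x n a f"
    unfolding analytic_solution_def using f V W
    by (intro conjI exI[of _ "V \<inter> W"] exI[of _ g]) (auto intro: holomorphic_on_subset)
qed

text \<open>On a closed disc around \<open>x\<close> the derivative of order \<open>n + 1\<close> of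
  the extension is bounded, so the Taylor remainder is \<open>O(|z - x|^(n+1))\<close>.\<close>

lemma analytic_imp_weak_solution:
  assumes "analytic_solution x n a f"
  shows "weak_solution x n a f"
proof -
  obtain U g where f: "f \<in> pick_class" and U: "open U" "complex_of_real x \<in> U" "g holomorphic_on U"
      "\<And>z. z \<in> U \<inter> upper_half_plane \<Longrightarrow> g z = f z"
      "\<And>k. k \<le> n \<Longrightarrow> (deriv ^^ k) g (complex_of_real x) / fact k = complex_of_real (a k)"
    using assms unfolding analytic_solution_def by blast
  define h where "h z = f z - (\<Sum>k\<le>n. complex_of_real (a k) * (z - complex_of_real x) ^ k)" for z
  obtain r where r: "0 < r" "cball (complex_of_real x) r \<subseteq> U"
    using U(1,2) open_contains_cball by blast
  have "(deriv ^^ Suc n) g holomorphic_on U"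
    by (intro holomorphic_higher_deriv U)
  then have "compact ((deriv ^^ Suc n) g ` cball (complex_of_real x) r)"
    by (intro compact_continuous_image compact_cball) (meson r(2) holomorphic_on_imp_continuous_on holomorphic_on_subset)
  then obtain B where B: "\<And>z. z \<in> cball (complex_of_real x) r \<Longrightarrow> cmod ((deriv ^^ Suc n) g z) \<le> B"
    using compact_imp_bounded bounded_iff by (metis image_eqI)
  have bound: "cmod (h z / (z - of_real x) ^ n) \<le> B / fact n * cmod (z - of_real x)"
    if z: "z \<in> upper_half_plane" "z \<in> cball (of_real x) r" for z
  proof -
    have "cmod ((deriv ^^ 0) g z - (\<Sum>i\<le>n. (deriv ^^ i) g (of_real x) * (z - of_real x) ^ i / fact i))
        \<le> B * cmod (z - of_real x) ^ Suc n / fact n"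
    proof (rule complex_Taylor[where S = "cball (of_real x) r" and f = "\<lambda>i. (deriv ^^ i) g"])
      show "((deriv ^^ i) g has_field_derivative (deriv ^^ Suc i) g w) (at w within cball (of_real x) r)"
        if "w \<in> cball (of_real x) r" for i w
        using has_field_derivative_higher_deriv[OF U(3,1), of w i] r(2) that
        by (blast intro: has_field_derivative_at_within)
      show "cmod ((deriv ^^ Suc n) g w) \<le> B" if "w \<in> cball (of_real x) r" for w
        using B that .
    qed (use r(1) z(2) in auto)
    also have "(\<Sum>i\<le>n. (deriv ^^ i) g (of_real x) * (z - of_real x) ^ i / fact i) =
        (\<Sum>k\<le>n. complex_of_real (a k) * (z - complex_of_real x) ^ k)"
      by (intro sum.cong refl) (simp flip: U(5))
    also have "(deriv ^^ 0) g z = f z" using U(4) z r(2) by auto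
    finally have "cmod (h z) \<le> B * cmod (z - of_real x) ^ Suc n / fact n"
      by (simp add: h_def)
    moreover have "0 < cmod (z - of_real x)" using z(1) by (auto simp: upper_half_plane_iff)
    ultimately show ?thesis by (simp add: norm_divide norm_power field_simps)
  qed
  have "((\<lambda>z. h z / (z - of_real x) ^ n) \<longlongrightarrow> 0) (at (of_real x) within S)" if S: "nontangential_set x S" for S
  proof (rule Lim_null_comparison)
    show "((\<lambda>z. B / fact n * cmod (z - of_real x)) \<longlongrightarrow> 0) (at (of_real x) within S)"
      by (auto intro!: tendsto_eq_intros)
    show "eventually (\<lambda>z. cmod (h z / (z - of_real x) ^ n) \<le> B / fact n * cmod (z - of_real x)) (at (of_real x) within S)"
      unfolding eventually_at using r(1) S bound
      by (intro exI[of _ r]) (auto simp: nontangential_set_def dist_commute)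
  qed
  then show ?thesis
    using f by (simp add: weak_solution_def little_o_nt_def nt_tendsto_def h_def)
qed

lemma analytic_imp_nontangential_solution:
  assumes "analytic_solution x n a f"
  shows "nontangential_solution x n a f"
proof -
  obtain U g where f: "f \<in> pick_class" and U: "open U" "complex_of_real x \<in> U" "g holomorphic_on U"
      "\<And>z. z \<in> U \<inter> upper_half_plane \<Longrightarrow> g z = f z"
      "\<And>k. k \<le> n \<Longrightarrow> (deriv ^^ k) g (complex_of_real x) / fact k = complex_of_real (a k)"
    using assms unfolding analytic_solution_def by blast
  have "((\<lambda>z. (deriv ^^ k) f z / fact k) \<longlongrightarrow> complex_of_real (a k)) (at (of_real x) within S)"
    if S: "nontangential_set x S" and k: "k \<le> n" for S k
  proof -
    have "(deriv ^^ k) g holomorphic_on U"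
      by (intro holomorphic_higher_deriv U)
    then have "isCont ((deriv ^^ k) g) (of_real x)"
      using U(1,2) by (meson continuous_on_eq_continuous_at holomorphic_on_imp_continuous_on)
    then have "((\<lambda>z. (deriv ^^ k) g z / fact k) \<longlongrightarrow> (deriv ^^ k) g (of_real x) / fact k) (at (of_real x) within S)"
      by (intro tendsto_intros) (auto simp: isCont_def intro: tendsto_within_subset)
    moreover have "eventually (\<lambda>z. (deriv ^^ k) g z / fact k = (deriv ^^ k) f z / fact k) (at (of_real x) within S)"
    proof -
      have "eventually (\<lambda>z. z \<in> U) (at (complex_of_real x) within S)"
        using U(1,2) by (meson eventually_at_topological)
      moreover have "eventually (\<lambda>z. z \<in> S) (at (complex_of_real x) within S)"
        by (simp add: eventually_at_filter)
      ultimately show ?thesis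
      proof eventually_elim
        case (elim z)
        then have "z \<in> U \<inter> upper_half_plane" using S by (auto simp: nontangential_set_def)
        \<comment> \<open>Equality of derivatives requires equality on an open set; the set
          \<open>S\<close> need not be open, but its points in \<open>U\<close> lie in the open set
          \<open>U \<inter> upper_half_plane\<close>.\<close>
        then have "(deriv ^^ k) g z = (deriv ^^ k) f z"
          using U f open_upper_half_plane
          by (intro higher_deriv_transform_within_open[of _ "U \<inter> upper_half_plane"])
            (auto simp: pick_class_def intro: holomorphic_on_subset)
        then show ?case by simp
      qed
    qed
    ultimately show ?thesis using U(5)[OF k] by (simp add: tendsto_cong)
  qed
  then show ?thesis using f by (simp add: nontangential_solution_def nt_tendsto_def)
qed

text \<open>The vertical ray is itself a nontangential set, with ratio constantly 1.\<close>

lemma nt_tendsto_imp_radial: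
  assumes "nt_tendsto h l x"
  shows "(h \<longlongrightarrow> l) (radial_filter x)"
proof -
  define S where "S = (\<lambda>y. Complex x y) ` {0<..}"
  have lim: "filterlim (\<lambda>y. Complex x y) (at (of_real x) within S) (at_right 0)"
    unfolding filterlim_at
  proof
    show "eventually (\<lambda>y. Complex x y \<in> S \<and> Complex x y \<noteq> of_real x) (at_right 0)"
      by (auto simp: eventually_at_filter S_def complex_eq_iff)
    have "((\<lambda>z. z - of_real x + of_real x) \<longlongrightarrow> 0 + complex_of_real x) (radial_filter x)"
      by (intro tendsto_intros tendsto_radial_filter_ident)
    then show "((\<lambda>y. Complex x y) \<longlongrightarrow> of_real x) (at_right 0)"
      by (simp add: tendsto_radial_filter_iff)
  qed
  \<comment> \<open>The ray carries the nontrivial filter \<open>at_right 0\<close> into this one,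
    which puts \<open>x\<close> into the closure of \<open>S\<close>.\<close>
  have "at (complex_of_real x) within S \<noteq> bot"
    using filterlim_at_within_not_equal lim filterlim_mono_eventually by (metis bot.extremum_uniqueI filterlim_def filtermap_bot_iff trivial_limit_at_right_real)
  then have "of_real x \<in> closure S"
    using trivial_limit_within by (metis Un_iff closure_def islimpt_in_closure mem_Collect_eq)
  moreover have "cmod (Complex x y - of_real x) / y = 1" if "0 < y" for y
  proof -
    have "Complex x y - of_real x = \<i> * of_real y" by (simp add: complex_eq_iff)
    then show ?thesis using that by (simp add: norm_mult)
  qed
  then have "(\<lambda>z. cmod (z - of_real x) / Im z) ` S \<subseteq> {1}"
    by (auto simp: S_def)
  then have "bounded ((\<lambda>z. cmod (z - of_real x) / Im z) ` S)"
    by (rule bounded_subset[rotated]) simp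
  ultimately have "nontangential_set x S"
    by (auto simp: nontangential_set_def S_def upper_half_plane_iff)
  then have "(h \<longlongrightarrow> l) (at (of_real x) within S)"
    using assms by (simp add: nt_tendsto_def)
  then show ?thesis
    unfolding tendsto_radial_filter_iff using lim by (rule filterlim_compose)
qed

lemma weak_imp_radial_expansion:
  assumes "weak_solution x n a f"
  shows "f \<in> pick_class" "radial_expansion x n a f"
  using assms by (simp_all add: weak_solution_def little_o_nt_def radial_expansion_def nt_tendsto_imp_radial)

lemma nontangential_imp_radial_solution:
  assumes "nontangential_solution x n a f"
  shows "radial_solution x n a f"
  unfolding radial_solution_def
proof (intro conjI allI impI)
  show "f \<in> pick_class" using assms by (simp add: nontangential_solution_def)
  fix k assume "k \<le> n"
  then have "((\<lambda>z. (deriv ^^ k) f z / fact k) \<longlongrightarrow> of_real (a k)) (radial_filter x)"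
    using assms by (intro nt_tendsto_imp_radial) (simp add: nontangential_solution_def)
  then show "((\<lambda>y. (deriv ^^ k) f (Complex x y) / fact k) \<longlongrightarrow> of_real (a k)) (at_right 0)"
    by (simp add: tendsto_radial_filter_iff)
qed

text \<open>After subtraction of the Taylor polynomial all derivatives up to order \<open>n\<close>
  tend to 0 along the line. Taylor's formula up to degree \<open>n - 1\<close>, with the derivative
  of order \<open>n\<close> below \<open>\<epsilon>\<close> in the remainder, then gives the
  expansion.\<close>

lemma radial_imp_radial_expansion:
  assumes "radial_solution x n a f"
  shows "radial_expansion x n a f"
proof (cases n)
  case 0
  have "(f \<longlongrightarrow> of_real (a 0)) (radial_filter x)"
    using assms by (auto simp: radial_solution_def tendsto_radial_filter_iff 0)
  then have "((\<lambda>z. f z - of_real (a 0)) \<longlongrightarrow> of_real (a 0) - of_real (a 0)) (radial_filter x)"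
    by (intro tendsto_intros)
  then show ?thesis by (simp add: radial_expansion_def 0)
next
  case (Suc n')
  have holo: "f holomorphic_on upper_half_plane"
    using assms by (simp add: radial_solution_def pick_class_def)
  define P where "P = (\<Sum>k\<le>n. Polynomial.monom (complex_of_real (a k)) k)"
  define F where "F i z = (deriv ^^ i) f z - poly ((pderiv ^^ i) P) (z - of_real x)" for i z
  have deriv_F: "(F i has_field_derivative F (Suc i) z) (at z within T)" if "0 < Im z" for i z T
  proof -
    have "((deriv ^^ i) f has_field_derivative (deriv ^^ Suc i) f z) (at z within T)"
      using has_field_derivative_higher_deriv[OF holo open_upper_half_plane, of z i] that
      by (simp add: upper_half_plane_iff has_field_derivative_at_within)
    moreover have "((\<lambda>z. poly ((pderiv ^^ i) P) (z - of_real x)) has_field_derivative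
        poly (pderiv ((pderiv ^^ i) P)) (z - of_real x) * (1 - 0)) (at z within T)"
      by (rule DERIV_chain2[OF poly_DERIV]) (intro derivative_intros)
    ultimately show ?thesis
      unfolding F_def[abs_def] by (auto intro: DERIV_diff)
  qed
  have lim_F: "(F i \<longlongrightarrow> 0) (radial_filter x)" if i: "i \<le> n" for i
  proof -
    have "((\<lambda>z. (deriv ^^ i) f z / fact i) \<longlongrightarrow> of_real (a i)) (radial_filter x)"
      using assms i by (simp add: radial_solution_def tendsto_radial_filter_iff)
    then have "((\<lambda>z. fact i * ((deriv ^^ i) f z / fact i) - poly ((pderiv ^^ i) P) (z - of_real x)) \<longlongrightarrow>
        fact i * of_real (a i) - poly ((pderiv ^^ i) P) 0) (radial_filter x)"
      by (intro tendsto_intros tendsto_radial_filter_ident)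
    moreover have "poly ((pderiv ^^ i) P) 0 = fact i * of_real (a i)"
      using i by (simp add: poly_0_coeff_0 coeff_higher_pderiv P_def coeff_sum pochhammer_fact)
    ultimately show ?thesis by (simp add: F_def[abs_def])
  qed
  have small: "eventually (\<lambda>z. cmod (F 0 z / (z - of_real x) ^ n) \<le> \<epsilon>) (radial_filter x)" if \<epsilon>: "0 < \<epsilon>" for \<epsilon>
  proof -
    have "eventually (\<lambda>z. cmod (F n z) < \<epsilon>) (radial_filter x)"
      using tendstoD[OF lim_F[of n] \<epsilon>] by (simp add: dist_norm)
    then obtain \<delta> where \<delta>: "0 < \<delta>" "\<And>y. 0 < y \<Longrightarrow> y < \<delta> \<Longrightarrow> cmod (F n (Complex x y)) < \<epsilon>"
      unfolding radial_filter_def eventually_filtermap eventually_at_right_field by auto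
    define S where "S = {z. Re z = x \<and> 0 < Im z \<and> Im z < \<delta>}"
    have "convex S"
    proof -
      have "S = {z. Re z \<le> x} \<inter> {z. x \<le> Re z} \<inter> {z. 0 < Im z} \<inter> {z. Im z < \<delta>}" by (auto simp: S_def)
      then show ?thesis
        by (simp add: convex_Int convex_halfspace_Im_gt convex_halfspace_Im_lt convex_halfspace_Re_le
            convex_halfspace_Re_ge)
    qed
    have S_bound: "cmod (F (Suc n') z) \<le> \<epsilon>" if "z \<in> S" for z
      using \<delta>(2)[of "Im z"] that by (auto simp: S_def Suc complex_surj less_imp_le)
    have ev_S: "eventually (\<lambda>z. z \<in> S) (radial_filter x)"
      unfolding radial_filter_def eventually_filtermap eventually_at_right_field S_def
      using \<delta>(1) by auto
    have "cmod (F 0 z / (z - of_real x) ^ n) \<le> \<epsilon>" if z: "z \<in> S" for z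
    proof -
      \<comment> \<open>The base point is some \<open>w\<close> on the segment above
        \<open>x\<close>, where \<open>f\<close> is holomorphic; as \<open>w\<close> tends to
        \<open>x\<close>, all Taylor terms vanish in the limit.\<close>
      have taylor: "cmod (F 0 z - (\<Sum>i\<le>n'. F i w * (z - w) ^ i / fact i)) \<le> \<epsilon> * cmod (z - w) ^ Suc n' / fact n'"
        if "w \<in> S" for w
        using \<open>convex S\<close> S_bound that z deriv_F
        by (intro complex_Taylor[where S = S]) (auto simp: S_def)
      have "((\<lambda>z. z - of_real x + of_real x) \<longlongrightarrow> 0 + complex_of_real x) (radial_filter x)"
        by (intro tendsto_intros tendsto_radial_filter_ident)
      then have lim_w: "((\<lambda>w. w) \<longlongrightarrow> complex_of_real x) (radial_filter x)" by simp
      have lhs: "((\<lambda>w. cmod (F 0 z - (\<Sum>i\<le>n'. F i w * (z - w) ^ i / fact i))) \<longlongrightarrow>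
          cmod (F 0 z - (\<Sum>i\<le>n'. 0 * (z - of_real x) ^ i / fact i))) (radial_filter x)"
        using Suc by (intro tendsto_intros lim_F lim_w) auto
      have rhs: "((\<lambda>w. \<epsilon> * cmod (z - w) ^ Suc n' / fact n') \<longlongrightarrow> \<epsilon> * cmod (z - of_real x) ^ Suc n' / fact n') (radial_filter x)"
        by (intro tendsto_intros lim_w) auto
      have "cmod (F 0 z - (\<Sum>i\<le>n'. 0 * (z - of_real x) ^ i / fact i)) \<le> \<epsilon> * cmod (z - of_real x) ^ Suc n' / fact n'"
        using eventually_mono[OF ev_S taylor] by (rule tendsto_le[OF radial_filter_nontrivial rhs lhs])
      then have "cmod (F 0 z) \<le> \<epsilon> * cmod (z - of_real x) ^ n / fact n'"
        by (simp add: Suc)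
      also have "\<dots> \<le> \<epsilon> * cmod (z - of_real x) ^ n / 1"
        using \<epsilon> by (intro divide_left_mono) (auto simp: fact_ge_1)
      finally have "cmod (F 0 z) \<le> \<epsilon> * cmod (z - of_real x) ^ n" by simp
      moreover have "0 < cmod (z - of_real x)" using z by (auto simp: S_def complex_eq_iff)
      ultimately show ?thesis by (simp add: norm_divide norm_power divide_le_eq)
    qed
    then show ?thesis using ev_S by (rule eventually_mono[rotated])
  qed
  have "((\<lambda>z. F 0 z / (z - of_real x) ^ n) \<longlongrightarrow> 0) (radial_filter x)"
  proof (rule tendstoI)
    fix \<epsilon> :: real assume "0 < \<epsilon>"
    then have "eventually (\<lambda>z. cmod (F 0 z / (z - of_real x) ^ n) \<le> \<epsilon> / 2) (radial_filter x)"
      by (intro small) simp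
    then show "eventually (\<lambda>z. dist (F 0 z / (z - of_real x) ^ n) 0 < \<epsilon>) (radial_filter x)"
      by eventually_elim (use \<open>0 < \<epsilon>\<close> in \<open>simp add: dist_norm\<close>)
  qed
  then show ?thesis
    by (simp add: radial_expansion_def F_def P_def poly_sum poly_monom)
qed

text \<open>The inverse of Julia reduction, in a form without a pole at \<open>x\<close>: the
  expression being inverted has the value \<open>1 / a 1\<close> there.\<close>

lemma Julia_augmentation:
  assumes sol: "analytic_solution x n (reduced_coeffs a) g" and a1: "0 < a 1"
  shows "analytic_solution x (n + 2) a
    (\<lambda>z. of_real (a 0) + (z - of_real x) * inverse (1 / of_real (a 1) - (z - of_real x) * g z))"
    (is "analytic_solution _ _ _ ?f")
proof -
  obtain G F where g: "g \<in> pick_class" and F: "(\<lambda>t. G (of_real x + t)) has_fps_expansion F"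
    and ev: "eventually (\<lambda>z. z \<in> upper_half_plane \<longrightarrow> G z = g z) (nhds (of_real x))"
    and coeff: "\<And>k. k \<le> n \<Longrightarrow> fps_nth F k = of_real (reduced_coeffs a k)"
    using sol unfolding analytic_solution_iff_fps by blast
  have Im_pos: "0 < Im (g z - 1 / (of_real (a 1) * (z - of_real x)))" if z: "0 < Im z" for z
  proof -
    have "0 < (cmod (z - of_real x))\<^sup>2" using z by auto
    then have "Im (1 / (z - of_real x)) < 0"
      using z by (simp add: Im_divide cmod_power2)
    moreover have "1 / (of_real (a 1) * (z - of_real x)) = of_real (1 / a 1) * (1 / (z - of_real x))"
      by simp
    moreover have "0 \<le> Im (g z)" using g z by (simp add: pick_class_def upper_half_plane_iff)
    moreover from \<open>Im (1 / (z - of_real x)) < 0\<close> have "Im (1 / (z - of_real x)) / a 1 < 0"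
      using a1 by (rule divide_neg_pos)
    ultimately show ?thesis
      by (simp only: minus_complex.simps Im_complex_of_real Re_complex_of_real times_complex.simps) simp
  qed
  \<comment> \<open>This second form is singular at \<open>x\<close> but shows membership in the
    Pick class: the inverted function has positive imaginary part.\<close>
  have f_eq: "?f z = of_real (a 0) - 1 / (g z - 1 / (of_real (a 1) * (z - of_real x)))"
    and f_ne: "1 / of_real (a 1) - (z - of_real x) * g z \<noteq> 0" if z: "0 < Im z" for z
  proof -
    have eq: "1 / c - \<zeta> * u = - \<zeta> * (u - 1 / (c * \<zeta>))" "\<zeta> * inverse (- \<zeta> * v) = - (1 / v)"
      if "\<zeta> \<noteq> 0" for \<zeta> c u v :: complex
      using that by (auto simp: right_diff_distrib field_simps)
    have \<zeta>: "z - of_real x \<noteq> 0" using z by auto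
    show "?f z = of_real (a 0) - 1 / (g z - 1 / (of_real (a 1) * (z - of_real x)))"
      unfolding eq(1)[OF \<zeta>] eq(2)[OF \<zeta>] by simp
    show "1 / of_real (a 1) - (z - of_real x) * g z \<noteq> 0"
      unfolding eq(1)[OF \<zeta>] using \<zeta> Im_pos[OF z] by fastforce
  qed
  have pick: "?f \<in> pick_class"
    unfolding pick_class_def
  proof (intro CollectI conjI ballI)
    show "?f holomorphic_on upper_half_plane"
      using g f_ne by (intro holomorphic_intros) (auto simp: pick_class_def upper_half_plane_iff)
    fix z assume "z \<in> upper_half_plane"
    then have z: "0 < Im z" by (simp add: upper_half_plane_iff)
    have "0 \<le> Im (of_real c - 1 / u)" if "0 < Im u" for u c
      using that by (simp add: Im_divide)
    then show "0 \<le> Im (?f z)"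
      unfolding f_eq[OF z] using Im_pos[OF z] by blast
  qed
  define q where "q = fps_const (1 / complex_of_real (a 1)) - fps_X * F"
  define H where "H = fps_const (of_real (a 0)) + fps_X * inverse q"
  have q0: "fps_nth q 0 \<noteq> 0" using a1 by (simp add: q_def)
  have "(\<lambda>t. of_real (a 0) + t * inverse (1 / of_real (a 1) - t * G (of_real x + t))) has_fps_expansion H"
    unfolding H_def q_def by (intro fps_expansion_intros F) (use a1 in simp)
  then have exp: "(\<lambda>t. of_real (a 0) + (of_real x + t - of_real x) * inverse (1 / of_real (a 1) - (of_real x + t - of_real x) * G (of_real x + t)))
      has_fps_expansion H" by simp
  have H: "fps_nth H k = of_real (a k)" if "k \<le> n + 2" for k
  proof (cases k)
    case (Suc k')
    define p where "p = Abs_fps (\<lambda>k. complex_of_real (a (Suc k)))"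
    define q' where "q' = Abs_fps (\<lambda>k. complex_of_real (fps_nth (inverse (Abs_fps (\<lambda>k. a (Suc k)))) k))"
    have "q' * p = 1"
    proof (rule fps_ext)
      fix n
      have "fps_nth (q' * p) n = of_real (\<Sum>i\<le>n. fps_nth (inverse (Abs_fps (\<lambda>k. a (Suc k)))) i * a (Suc (n - i)))"
        by (simp add: fps_mult_nth q'_def p_def atLeast0AtMost)
      also have "\<dots> = fps_nth 1 n"
        using inverse_fps_convolution[of "\<lambda>k. a (Suc k)", OF _ refl, of n] a1 by simp
      finally show "fps_nth (q' * p) n = fps_nth 1 n" .
    qed
    moreover have "inverse q * q = 1" using q0 by (rule inverse_mult_eq_1)
    \<comment> \<open>\<open>q\<close> agrees with the exact inverse \<open>q'\<close> of
      \<open>p\<close> up to degree \<open>n + 1\<close>. The factorization transfers this to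
      \<open>inverse q\<close> and \<open>p\<close>, and the factor \<open>fps_X\<close> in
      \<open>H\<close> adds one more degree.\<close>
    ultimately have "inverse q - p = (q' - q) * (inverse q * p)"
      by (simp add: algebra_simps)
    moreover have "fps_nth (q' - q) j = 0" if "j \<le> n + 1" for j
      using that coeff[of "j - 1"] a1 by (cases j) (auto simp: q'_def q_def reduced_coeffs_def field_simps)
    then have "fps_nth ((q' - q) * (inverse q * p)) k' = 0"
      unfolding fps_mult_nth using Suc \<open>k \<le> n + 2\<close> by (intro sum.neutral) auto
    ultimately have "fps_nth (inverse q) k' = fps_nth p k'"
      by (metis eq_iff_diff_eq_0 fps_sub_nth)
    then show ?thesis by (simp add: H_def Suc p_def)
  qed (simp add: H_def)
  have ev_f: "eventually (\<lambda>z. z \<in> upper_half_plane \<longrightarrow>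
      of_real (a 0) + (z - of_real x) * inverse (1 / of_real (a 1) - (z - of_real x) * G z) = ?f z) (nhds (of_real x))"
    using ev by eventually_elim auto
  show ?thesis
    unfolding analytic_solution_iff_fps
    by (intro conjI pick exI[of _ "\<lambda>z. of_real (a 0) + (z - of_real x) * inverse (1 / of_real (a 1) - (z - of_real x) * G z)"]
        exI[of _ H] exp ev_f allI impI H)
qed

section \<open>Necessity, existence and uniqueness by induction on \<open>m\<close>\<close>

lemma radial_expansion_imp_hankel:
  assumes "f \<in> pick_class" "radial_expansion x (2 * m) a f"
  shows "hankel_pos m a \<or> hankel_degenerate m a"
  using assms
proof (induction m arbitrary: a f)
  case (Suc m)
  show ?case
  proof (cases "a 1 = 0")
    case True
    \<comment> \<open>Here the reduction stops: \<open>f\<close> is constant, which is the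
      degenerate case with \<open>r = 0\<close>.\<close>
    have "a (Suc i) = 0" if "i < 2 * Suc m" for i
      by (rule pick_zero_derivative_imp_constant(2)[where k = "Suc i", OF Suc.prems _ True]) (use that in auto)
    then show ?thesis using True by (simp add: hankel_degenerate_Suc)
  next
    case False
    then have a1: "0 < a 1" using Julia_inequality(1)[OF Suc.prems] by simp
    have exp: "radial_expansion x (2 * m + 2) a f" using Suc.prems(2) by simp
    have "hankel_pos m (reduced_coeffs a) \<or> hankel_degenerate m (reduced_coeffs a)"
      by (rule Suc.IH[OF Julia_reduction(1,2)[of f x "2 * m" a, OF Suc.prems(1) exp a1]])
    then show ?thesis using a1 by (simp add: hankel_degenerate_Suc hankel_pos_Suc)
  qed
qed (simp add: hankel_pos_0)

lemma const_analytic_solution: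
  assumes "\<And>k. 0 < k \<Longrightarrow> k \<le> n \<Longrightarrow> a k = 0"
  shows "analytic_solution x n a (\<lambda>_. of_real (a 0))"
  unfolding analytic_solution_iff_fps
proof (intro conjI exI[of _ "\<lambda>_. of_real (a 0)"] exI[of _ "fps_const (of_real (a 0))"] allI impI)
  show "fps_nth (fps_const (complex_of_real (a 0))) k = of_real (a k)" if "k \<le> n" for k
    using assms that by (cases "k = 0") auto
qed (auto simp: pick_class_def)

text \<open>After \<open>m\<close> reductions only the value at \<open>x\<close> is prescribed,
  which leaves freedom such as adding \<open>z - x\<close>. Julia augmentation is injective at each
  point of the half-plane, so distinct solutions stay distinct.\<close>

lemma hankel_pos_imp_two_analytic_solutions:
  assumes "hankel_pos m a"
  shows "\<exists>f g. analytic_solution x (2 * m) a f \<and> analytic_solution x (2 * m) a g \<and>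
    (\<exists>z\<in>upper_half_plane. f z \<noteq> g z)"
  using assms
proof (induction m arbitrary: a)
  case 0
  have "analytic_solution x 0 a (\<lambda>z. of_real (a 0) + (z - of_real x))"
    unfolding analytic_solution_iff_fps
  proof (intro conjI exI[of _ "\<lambda>z. of_real (a 0) + (z - of_real x)"] exI[of _ "fps_const (of_real (a 0)) + fps_X"] allI impI)
    show "(\<lambda>t. of_real (a 0) + (of_real x + t - of_real x)) has_fps_expansion fps_const (complex_of_real (a 0)) + fps_X"
      by (simp add: fps_expansion_intros)
  qed (auto simp: pick_class_def upper_half_plane_iff intro!: holomorphic_intros)
  moreover have "analytic_solution x 0 a (\<lambda>_. of_real (a 0))"
    by (rule const_analytic_solution) simp
  moreover have "\<i> \<in> upper_half_plane" "complex_of_real (a 0) + (\<i> - of_real x) \<noteq> of_real (a 0)"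
    by (auto simp: upper_half_plane_iff complex_eq_iff)
  ultimately show ?case by (metis mult_0_right)
next
  case (Suc m)
  have a1: "0 < a 1" and pos: "hankel_pos m (reduced_coeffs a)"
    using Suc.prems hankel_pos_Suc by blast+
  obtain f g z where sol: "analytic_solution x (2 * m) (reduced_coeffs a) f"
      "analytic_solution x (2 * m) (reduced_coeffs a) g" and z: "0 < Im z" "f z \<noteq> g z"
    using Suc.IH[OF pos] by (auto simp: upper_half_plane_iff)
  define A where "A h z = of_real (a 0) + (z - of_real x) * inverse (1 / of_real (a 1) - (z - of_real x) * h z)"
    for h :: "complex \<Rightarrow> complex" and z
  have "analytic_solution x (2 * Suc m) a (A f)" "analytic_solution x (2 * Suc m) a (A g)"
    using Julia_augmentation[of x "2 * m" a, OF _ a1] sol by (simp_all add: A_def[abs_def])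
  moreover have "z - of_real x \<noteq> 0" using z by (auto simp: complex_eq_iff)
  then have "A f z \<noteq> A g z" using z(2) by (simp add: A_def)
  ultimately show ?case
    using z(1) by (intro exI[of _ "A f"] exI[of _ "A g"] conjI bexI[of _ z]) (simp_all add: upper_half_plane_iff)
qed

text \<open>The recursion \<open>hankel_degenerate_Suc\<close> ends in data whose coefficients of
  positive index vanish; a constant solves these, and Julia augmentation leads back.\<close>

lemma hankel_degenerate_imp_analytic_solution:
  assumes "hankel_degenerate m a"
  shows "\<exists>f. analytic_solution x (2 * m) a f"
  using assms
proof (induction m arbitrary: a)
  case 0
  then show ?case by (simp add: hankel_degenerate_def)
next
  case (Suc m)
  show ?case
  proof (cases "0 < a 1")
    case True
    then obtain g where "analytic_solution x (2 * m) (reduced_coeffs a) g"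
      using Suc by (auto simp: hankel_degenerate_Suc)
    then show ?thesis using Julia_augmentation[of x "2 * m" a g] True by auto
  next
    case False
    then have "a (Suc i) = 0" if "i < 2 * Suc m" for i
      using Suc.prems that by (simp add: hankel_degenerate_Suc)
    then have "analytic_solution x (2 * Suc m) a (\<lambda>_. of_real (a 0))"
      by (intro const_analytic_solution) (metis Suc_le_lessD Suc_pred)
    then show ?thesis by blast
  qed
qed

text \<open>Phrased with radial expansions, the property that \<open>Julia_reduction\<close> hands
  on. Both functions are reduced until both are constant, and the inversion formula recovers their
  equality.\<close>

lemma hankel_degenerate_imp_unique:
  assumes "hankel_degenerate m a" and "f \<in> pick_class" "radial_expansion x (2 * m) a f"
    and "g \<in> pick_class" "radial_expansion x (2 * m) a g" and "0 < Im z"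
  shows "f z = g z"
  using assms
proof (induction m arbitrary: a f g)
  case 0
  then show ?case by (simp add: hankel_degenerate_def)
next
  case (Suc m)
  show ?case
  proof (cases "0 < a 1")
    case True
    let ?R = "\<lambda>h z. 1 / (of_real (a 1) * (z - of_real x)) - 1 / (h z - of_real (a 0))"
    have exp: "radial_expansion x (2 * m + 2) a f" "radial_expansion x (2 * m + 2) a g"
      using Suc.prems by simp_all
    note f = Julia_reduction[of f x "2 * m" a, OF Suc.prems(2) exp(1) True]
      and g = Julia_reduction[of g x "2 * m" a, OF Suc.prems(4) exp(2) True]
    have "?R f z = ?R g z"
      using Suc.prems(1) True by (intro Suc.IH[OF _ f(1,2) g(1,2) Suc.prems(6)]) (simp add: hankel_degenerate_Suc)
    then show ?thesis
      using f(3)[OF Suc.prems(6)] g(3)[OF Suc.prems(6)] by simp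
  next
    case False
    then have "a 1 = 0" using Julia_inequality(1)[OF Suc.prems(2,3)] by simp
    then have "f z = of_real (a 0)" "g z = of_real (a 0)"
      using pick_zero_derivative_imp_constant(1)[OF Suc.prems(2,3)]
        pick_zero_derivative_imp_constant(1)[OF Suc.prems(4,5)] Suc.prems(6) by simp_all
    then show ?thesis by simp
  qed
qed

section \<open>The equivalences and the criterion for uniqueness\<close>

theorem theorem5p2:
  fixes n m :: nat and x :: real and a :: "nat \<Rightarrow> real"
  assumes "0 < n" and "n = 2 * m"
  shows
    "((\<exists>f. weak_solution x n a f) \<longleftrightarrow> (\<exists>f. nontangential_solution x n a f)) \<and>
     ((\<exists>f. nontangential_solution x n a f) \<longleftrightarrow> (\<exists>f. radial_solution x n a f)) \<and>
     ((\<exists>f. radial_solution x n a f) \<longleftrightarrow> (\<exists>f. analytic_solution x n a f)) \<and>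
     ((\<exists>f. analytic_solution x n a f) \<longleftrightarrow>
        pos_definite (hankel m a) \<or>
        (SE_minimally_positive m (hankel m a) \<and>
         star_condition m (vec_space.rank m (hankel m a)) a)) \<and>
     (has_unique_solution x n a \<longleftrightarrow>
        SE_minimally_positive m (hankel m a) \<and>
        star_condition m (vec_space.rank m (hankel m a)) a)"
proof -
  have "0 < m" using assms by simp
  \<comment> \<open>Each of the four existence statements is shown equivalent to
    \<open>P \<or> D\<close>: this yields an analytic solution, an analytic solution is one of every
    other kind, and each kind gives a radial expansion, which forces
    \<open>P \<or> D\<close>.\<close>
  define P where "P \<longleftrightarrow> hankel_pos m a"
  define D where "D \<longleftrightarrow> hankel_degenerate m a"
  have D: "SE_minimally_positive m (hankel m a) \<and> star_condition m (vec_space.rank m (hankel m a)) a \<longleftrightarrow> D"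
    unfolding D_def by (rule SE_minimally_positive_star_condition_iff[OF \<open>0 < m\<close>])
  have radial: "P \<or> D" if "f \<in> pick_class" "radial_expansion x n a f" for f
    using radial_expansion_imp_hankel that unfolding P_def D_def assms(2) by blast
  have weak: "P \<or> D" if "weak_solution x n a f" for f
    using radial weak_imp_radial_expansion[OF that] by blast
  have rad: "P \<or> D" if "radial_solution x n a f" for f
    using radial radial_imp_radial_expansion[OF that] that unfolding radial_solution_def by blast
  have nonunique: "\<not> has_unique_solution x n a" if P
    using hankel_pos_imp_two_analytic_solutions[of m a x] that
    unfolding has_unique_solution_def assms(2) P_def by metis
  have ex: "\<exists>f. analytic_solution x n a f" if "P \<or> D"
    using that hankel_pos_imp_two_analytic_solutions[of m a x] hankel_degenerate_imp_analytic_solution[of m a x]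
    unfolding P_def D_def assms(2) by blast
  have unique: "has_unique_solution x n a" if D
  proof -
    obtain f where f: "analytic_solution x n a f" using ex \<open>D\<close> by blast
    have "g z = f z" if "analytic_solution x n a g" "0 < Im z" for g z
      using hankel_degenerate_imp_unique[of m a g x f z] \<open>D\<close> that(2)
        weak_imp_radial_expansion[OF analytic_imp_weak_solution[OF f]]
        weak_imp_radial_expansion[OF analytic_imp_weak_solution[OF that(1)]]
      unfolding D_def assms(2) by blast
    then have "\<forall>g. analytic_solution x n a g \<longrightarrow> (\<forall>z\<in>upper_half_plane. g z = f z)"
      by (simp add: upper_half_plane_iff)
    then show ?thesis
      using f unfolding has_unique_solution_def by blast
  qed
  \<comment> \<open>A solution exists, so \<open>P \<or> D\<close>; and \<open>P\<close> is excluded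
    because it provides two different solutions.\<close>
  have "D" if "has_unique_solution x n a"
  proof -
    obtain f where "analytic_solution x n a f"
      using \<open>has_unique_solution x n a\<close> unfolding has_unique_solution_def by blast
    then have "P \<or> D" by (intro weak) (rule analytic_imp_weak_solution)
    then show D using nonunique that by blast
  qed
  then have uniq: "has_unique_solution x n a \<longleftrightarrow> D" using unique by blast
  have "(\<exists>f. analytic_solution x n a f) \<longleftrightarrow> P \<or> D"
    using ex weak analytic_imp_weak_solution by blast
  moreover have "(\<exists>f. weak_solution x n a f) \<longleftrightarrow> P \<or> D"
    using ex weak analytic_imp_weak_solution by blast
  moreover have "(\<exists>f. nontangential_solution x n a f) \<longleftrightarrow> P \<or> D"
    using ex rad analytic_imp_nontangential_solution nontangential_imp_radial_solution by blast
  moreover have "(\<exists>f. radial_solution x n a f) \<longleftrightarrow> P \<or> D"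
    using ex rad analytic_imp_nontangential_solution nontangential_imp_radial_solution by blast
  ultimately show ?thesis
    unfolding D uniq pos_definite_hankel P_def[symmetric] by simp
qed

end
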